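(* Let $I$ be an index set, $a^1,\dots,a^n,b\in\mathbb{R}^I$, $c\in\mathbb{R}^n$, and suppose the semi-infinite linear program of minimizing $\sum_k c_kx_k$ over $x\in\mathbb{R}^n$ subject to $\sum_k a^k(i)x_k\ge b(i)$ for all $i\in I$ is feasible and bounded. Let $Y\subseteq\mathbb{R}^I$ be a linear subspace containing $U=\mathrm{span}(a^1,\dots,a^n,b)$ and let $\hat Y=\{y\in Y : -\infty<OV(y)<\infty\}$, assumed to be a vector space containing $U$. Let $H$, $I_1,\dots,I_4$, $\tilde a^k$, $\overline{FM}$, $L$, $S$ be obtained from the Fourier-Motzkin procedure described in the context, and let $\tilde b=\overline{FM}(b)$. Suppose that $\overline{FM}(\hat Y)\subseteq\ell_\infty(H)$ and that the following two conditions hold. (DP.1) If $I_3\ne\emptyset$ and $\mathcal H_S$ denotes the set of all sequences $\{h_m\}_{m\in\mathbb{N}}\subseteq I_3$ with $\limsup_{m}\tilde b(h_m)<S(b)$, then $\sup\{\limsup_m\tilde b(h_m) : \{h_m\}_{m\in\mathbb N}\in\mathcal H_S\}<S(b)$. (DP.2) If $I_4\ne\emptyset$ and $\mathcal H_L$ denotes the set of all sequences $\{h_m\}_{m\in\mathbb{N}}\subseteq I_4$ with $\limsup_{m}\tilde b(h_m)<L(b)$ and $\lim_{m\to\infty}\sum_{k=\ell}^n|\tilde a^k(h_m)|=0$, then $\sup\{\limsup_m\tilde b(h_m) : \{h_m\}_{m\in\mathbb N}\in\mathcal H_L\}<L(b)$. Then property (DP) holds for the pair consisting of the primal and $\mathrm{DSILP}(\hat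 Y)$: for every $d\in\hat Y$ such that the primal with right-hand side $b+d$ is feasible, there exist an optimal solution $\psi^*$ of $\mathrm{DSILP}(\hat Y)$ and $\hat\epsilon>0$ such that $$OV(b+\epsilon d)=\psi^*(b+\epsilon d)=OV(b)+\epsilon\,\psi^*(d)\qquad\text{for all }\epsilon\in[0,\hat\epsilon].$$
   Context: Optimal values. For $y\in\mathbb{R}^I$, $OV(y)=\inf\{\sum_k c_kx_k : x\in\mathbb{R}^n,\ \sum_k a^k(i)x_k\ge y(i)\ \forall i\in I\}\in[-\infty,+\infty]$ ($+\infty$ if infeasible). Feasible and bounded means the feasible set is nonempty and the optimal value is $>-\infty$. Dual. For a linear subspace $V\subseteq\mathbb{R}^I$ containing $a^1,\dots,a^n,b$, $\mathrm{DSILP}(V)$ is the problem: maximize $\psi(b)$ over real linear functionals $\psi$ on $V$ that are positive ($\psi(y)\ge0$ whenever $y\in V$ and $y(i)\ge 0$ for all $i\in I$) and satisfy $\psi(a^k)=c_k$ for $k=1,\dots,n$. Fourier-Motzkin procedure. Consider the system in variables $(z,x_1,\dots,x_n)$ with rows indexed by $\{0\}\cup I$: row $0$ is $z-\sum_k c_kx_k\ge0$ and row $i\in I$ is $\sum_k a^k(i)x_k\ge y(i)$. At every stage each current row $r$ is a nonnegative finite combination of the original rows, with finitely supported multiplier vector $u^r:\{0\}\cup I\to[0,\infty)$: its coefficient on $x_k$ is $\langle(-c_k,a^k),u^r\rangle$, its coefficient on $z$ is $u^r(0)$, and its right-hand side is $\langle(0,y),u^r\rangle$, where $\langle v,u\rangle=\sum_{i\in\{0\}\cup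 I}v(i)u(i)$. Initially the rows are the original ones (unit multiplier vectors). The variables $x_1,\dots,x_n$ are processed one at a time ($z$ is never eliminated). When $x_j$ is processed: if there are both rows with positive and rows with negative coefficient on $x_j$, then $x_j$ is eliminated, i.e. rows with zero coefficient on $x_j$ are kept and all other rows are replaced by one new row for each pair $(p,q)$ with coefficient $\alpha_p>0$ in $p$ and $\alpha_q<0$ in $q$, with multiplier vector a positive multiple of $u^p/\alpha_p+u^q/|\alpha_q|$; if all coefficients on $x_j$ are zero nothing is done; otherwise (all nonzero coefficients have one sign) $x_j$ is left in the system. Rows containing $z$ are scaled so that $z$ has coefficient $1$. After relabeling, the variables left in the system are $x_\ell,\dots,x_n$ ($\ell=n+1$ if none). Fix one such output; it depends only on $a^1,\dots,a^n,c$, not on the right-hand side. Let $H$ be the index set of the final rows, $u^h$ ($h\in H$) their multiplier vectors, and $\tilde a^k(h)=\langle(-c_k,a^k),u^h\rangle$ (so $\tilde a^k(h)=0$ for $k<\ell$). $H$ is the disjoint union of: $I_1$ ($z$-coefficient $0$, all $\tilde a^k(h)=0$), $I_2$ ($z$-coefficient $0$, $\sum_{k=\ell}^n|\tilde a^k(h)|>0$), $I_3$ ($z$-coefficient $1$, all $\tilde a^k(h)=0$), $I_4$ ($z$-coefficient $1$, $\sum_{k=\ell}^n|\tilde a^k(h)|>0$). Operators and functions. $\overline{FM}:\mathbb{R}^I\to\mathbb{R}^H$ is the linear operator $\overline{FM}(y)(h)=\langle(0,y),u^h\rangle$. For $y\in\mathbb{R}^I$ with $\tilde y=\overline{FM}(y)$: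 $S(y)=\sup_{h\in I_3}\tilde y(h)$, and $L(y)=\lim_{\delta\to\infty}\omega(\delta,y)$ with $\omega(\delta,y)=\sup\{\tilde y(h)-\delta\sum_{k=\ell}^n|\tilde a^k(h)| : h\in I_4\}$ (nonincreasing in $\delta$). Values are in $[-\infty,+\infty]$ and $\sup\emptyset=-\infty$. $\ell_\infty(H)$ is the space of bounded real functions on $H$. *)

theory Defs
  imports "HOL-Analysis.Analysis" "HOL-Library.Function_Algebras"
begin

section \<open>Real functions on an index set\<close>

definition fscale :: "real \<Rightarrow> ('i \<Rightarrow> real) \<Rightarrow> 'i \<Rightarrow> real"  (infixr \<open>*\<^sub>F\<close> 75)
  where "r *\<^sub>F y = (\<lambda>i. r * y i)"

interpretation fun_vs: vector_space "fscale :: real \<Rightarrow> ('i \<Rightarrow> real) \<Rightarrow> 'i \<Rightarrow> real"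
  by unfold_locales (auto simp: fscale_def fun_eq_iff algebra_simps)

text \<open>Elements of \<open>\<real>\<^sup>I\<close> are represented by functions on the ambient type that vanish
  outside \<open>I\<close>, so that \<open>I\<close> may be any set (also the empty one).\<close>

definition RI :: "'i set \<Rightarrow> ('i \<Rightarrow> real) set"
  where "RI I = {y. \<forall>i. i \<notin> I \<longrightarrow> y i = 0}"

definition linf :: "'h set \<Rightarrow> ('h \<Rightarrow> real) set"
  where "linf H = {f. bounded (f ` H)}"


section \<open>The semi-infinite linear program and its dual\<close>

definition feasible_set :: "'i set \<Rightarrow> ('n::finite \<Rightarrow> 'i \<Rightarrow> real) \<Rightarrow> ('i \<Rightarrow> real) \<Rightarrow> (real ^ 'n) set"
  where "feasible_set I a y = {x. \<forall>i\<in>I. (\<Sum>k\<in>UNIV. a k i * x $ k) \<ge> y i}"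

definition OV :: "'i set \<Rightarrow> ('n::finite \<Rightarrow> 'i \<Rightarrow> real) \<Rightarrow> real ^ 'n \<Rightarrow> ('i \<Rightarrow> real) \<Rightarrow> ereal"
  where "OV I a c y = (INF x\<in>feasible_set I a y. ereal (\<Sum>k\<in>UNIV. c $ k * x $ k))"

definition linear_functional_on :: "('i \<Rightarrow> real) set \<Rightarrow> (('i \<Rightarrow> real) \<Rightarrow> real) \<Rightarrow> bool"
  where "linear_functional_on V \<psi> \<longleftrightarrow>
    (\<forall>y\<in>V. \<forall>w\<in>V. \<psi> (y + w) = \<psi> y + \<psi> w) \<and> (\<forall>r. \<forall>y\<in>V. \<psi> (r *\<^sub>F y) = r * \<psi> y)"

definition positive_on :: "'i set \<Rightarrow> ('i \<Rightarrow> real) set \<Rightarrow> (('i \<Rightarrow> real) \<Rightarrow> real) \<Rightarrow> bool"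
  where "positive_on I V \<psi> \<longleftrightarrow> (\<forall>y\<in>V. (\<forall>i\<in>I. y i \<ge> 0) \<longrightarrow> \<psi> y \<ge> 0)"

definition DSILP_feasible ::
    "'i set \<Rightarrow> ('n::finite \<Rightarrow> 'i \<Rightarrow> real) \<Rightarrow> real ^ 'n \<Rightarrow> ('i \<Rightarrow> real) set \<Rightarrow> (('i \<Rightarrow> real) \<Rightarrow> real) \<Rightarrow> bool"
  where "DSILP_feasible I a c V \<psi> \<longleftrightarrow>
    linear_functional_on V \<psi> \<and> positive_on I V \<psi> \<and> (\<forall>k. \<psi> (a k) = c $ k)"

definition DSILP_optimal ::
    "'i set \<Rightarrow> ('n::finite \<Rightarrow> 'i \<Rightarrow> real) \<Rightarrow> ('i \<Rightarrow> real) \<Rightarrow> real ^ 'n \<Rightarrow> ('i \<Rightarrow> real) set \<Rightarrow>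
      (('i \<Rightarrow> real) \<Rightarrow> real) \<Rightarrow> bool"
  where "DSILP_optimal I a b c V \<psi> \<longleftrightarrow>
    DSILP_feasible I a c V \<psi> \<and> (\<forall>\<phi>. DSILP_feasible I a c V \<phi> \<longrightarrow> \<phi> b \<le> \<psi> b)"


section \<open>The Fourier-Motzkin procedure\<close>

text \<open>The original rows \<open>{0} \<union> I\<close> are indexed by \<^typ>\<open>'i option\<close>: \<^term>\<open>None\<close> is the row of
  the objective, \<^term>\<open>Some i\<close> that of the \<open>i\<close>-th constraint. The pairing is meant for
  finitely supported \<open>u\<close>, and all multiplier vectors below are finitely supported.\<close>

definition pairing :: "('i option \<Rightarrow> real) \<Rightarrow> ('i option \<Rightarrow> real) \<Rightarrow> real"
  where "pairing v u = (\<Sum>r | u r \<noteq> 0. v r * u r)"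

definition var_coeff ::
    "('n::finite \<Rightarrow> 'i \<Rightarrow> real) \<Rightarrow> real ^ 'n \<Rightarrow> 'n \<Rightarrow> ('i option \<Rightarrow> real) \<Rightarrow> real"
  where "var_coeff a c k u = pairing (case_option (- (c $ k)) (a k)) u"

text \<open>Rows are identified by how they arise, so that distinct pairs always give distinct rows,
  even if their multiplier vectors coincide: \<open>Comb j p q\<close> is the row obtained from \<open>p\<close> and \<open>q\<close>
  when the variable \<open>j\<close> is eliminated. The multiplier vector of a new row is only determined up
  to a positive factor; \<open>\<sigma>\<close> collects the choices of these factors.\<close>

datatype ('i, 'n) fm_row = Orig "'i option" | Comb 'n "('i, 'n) fm_row" "('i, 'n) fm_row"

primrec multiplier ::
    "('n::finite \<Rightarrow> 'i \<Rightarrow> real) \<Rightarrow> real ^ 'n \<Rightarrow> (('i, 'n) fm_row \<Rightarrow> real) \<Rightarrow> ('i, 'n) fm_row \<Rightarrow>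
      'i option \<Rightarrow> real"
  where
    "multiplier a c \<sigma> (Orig r) = (\<lambda>s. if s = r then 1 else 0)"
  | "multiplier a c \<sigma> (Comb j p q) = (\<lambda>s. \<sigma> (Comb j p q) *
       (multiplier a c \<sigma> p s / var_coeff a c j (multiplier a c \<sigma> p) +
        multiplier a c \<sigma> q s / \<bar>var_coeff a c j (multiplier a c \<sigma> q)\<bar>))"

text \<open>A state consists of the set of current rows and the set of variables not eliminated
  so far. A variable all of whose coefficients vanish stays in the latter set; it contributes
  \<open>0\<close> to every sum over the remaining variables.\<close>

definition fm_step ::
    "(('i, 'n) fm_row \<Rightarrow> 'i option \<Rightarrow> real) \<Rightarrow> ('n::finite \<Rightarrow> 'i \<Rightarrow> real) \<Rightarrow> real ^ 'n \<Rightarrow> 'n \<Rightarrow>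
      ('i, 'n) fm_row set \<times> 'n set \<Rightarrow> ('i, 'n) fm_row set \<times> 'n set"
  where "fm_step u a c j = (\<lambda>(H, R).
    let P = {p \<in> H. var_coeff a c j (u p) > 0};
        N = {q \<in> H. var_coeff a c j (u q) < 0}
    in if P \<noteq> {} \<and> N \<noteq> {}
       then ({h \<in> H. var_coeff a c j (u h) = 0} \<union> {Comb j p q | p q. p \<in> P \<and> q \<in> N}, R - {j})
       else (H, R))"

definition fm_run ::
    "'i set \<Rightarrow> (('i, 'n) fm_row \<Rightarrow> 'i option \<Rightarrow> real) \<Rightarrow> ('n::finite \<Rightarrow> 'i \<Rightarrow> real) \<Rightarrow> real ^ 'n \<Rightarrow>
      'n list \<Rightarrow> ('i, 'n) fm_row set \<times> 'n set"
  where "fm_run I u a c js = fold (fm_step u a c) js (Orig ` insert None (Some ` I), UNIV)"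

text \<open>\<open>fm_output I a c H u R\<close>: some run of the procedure, processing each variable once in some
  order and with some choice of positive factors, ends with the rows \<open>H\<close>, their multiplier
  vectors \<open>u\<close>, and the remaining variables \<open>R\<close>, which correspond to \<open>x\<^sub>\<ell>, \<dots>, x\<^sub>n\<close> after
  relabeling.\<close>

definition fm_output ::
    "'i set \<Rightarrow> ('n::finite \<Rightarrow> 'i \<Rightarrow> real) \<Rightarrow> real ^ 'n \<Rightarrow>
      ('i, 'n) fm_row set \<Rightarrow> (('i, 'n) fm_row \<Rightarrow> 'i option \<Rightarrow> real) \<Rightarrow> 'n set \<Rightarrow> bool"
  where "fm_output I a c H u R \<longleftrightarrow>
    (\<exists>js \<sigma>. distinct js \<and> set js = UNIV \<and> (\<forall>r. \<sigma> r > 0) \<and> u = multiplier a c \<sigma> \<and>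
       (H, R) = fm_run I u a c js \<and> (\<forall>h\<in>H. u h None \<noteq> 0 \<longrightarrow> u h None = 1))"


section \<open>Operators and functions obtained from an output\<close>

definition a_tilde ::
    "('n::finite \<Rightarrow> 'i \<Rightarrow> real) \<Rightarrow> real ^ 'n \<Rightarrow> ('h \<Rightarrow> 'i option \<Rightarrow> real) \<Rightarrow> 'n \<Rightarrow> 'h \<Rightarrow> real"
  where "a_tilde a c u k h = var_coeff a c k (u h)"

definition FMbar :: "('h \<Rightarrow> 'i option \<Rightarrow> real) \<Rightarrow> ('i \<Rightarrow> real) \<Rightarrow> 'h \<Rightarrow> real"
  where "FMbar u y h = pairing (case_option 0 y) (u h)"

definition abs_sum ::
    "('n::finite \<Rightarrow> 'i \<Rightarrow> real) \<Rightarrow> real ^ 'n \<Rightarrow> ('h \<Rightarrow> 'i option \<Rightarrow> real) \<Rightarrow> 'n set \<Rightarrow> 'h \<Rightarrow> real"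
  where "abs_sum a c u R h = (\<Sum>k\<in>R. \<bar>a_tilde a c u k h\<bar>)"

definition I3 ::
    "('n::finite \<Rightarrow> 'i \<Rightarrow> real) \<Rightarrow> real ^ 'n \<Rightarrow> 'h set \<Rightarrow> ('h \<Rightarrow> 'i option \<Rightarrow> real) \<Rightarrow> 'h set"
  where "I3 a c H u = {h \<in> H. u h None = 1 \<and> (\<forall>k. a_tilde a c u k h = 0)}"

definition I4 ::
    "('n::finite \<Rightarrow> 'i \<Rightarrow> real) \<Rightarrow> real ^ 'n \<Rightarrow> 'h set \<Rightarrow> ('h \<Rightarrow> 'i option \<Rightarrow> real) \<Rightarrow> 'n set \<Rightarrow> 'h set"
  where "I4 a c H u R = {h \<in> H. u h None = 1 \<and> abs_sum a c u R h > 0}"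

definition S_val ::
    "('n::finite \<Rightarrow> 'i \<Rightarrow> real) \<Rightarrow> real ^ 'n \<Rightarrow> 'h set \<Rightarrow> ('h \<Rightarrow> 'i option \<Rightarrow> real) \<Rightarrow>
      ('i \<Rightarrow> real) \<Rightarrow> ereal"
  where "S_val a c H u y = (SUP h\<in>I3 a c H u. ereal (FMbar u y h))"

definition omega ::
    "('n::finite \<Rightarrow> 'i \<Rightarrow> real) \<Rightarrow> real ^ 'n \<Rightarrow> 'h set \<Rightarrow> ('h \<Rightarrow> 'i option \<Rightarrow> real) \<Rightarrow> 'n set \<Rightarrow>
      real \<Rightarrow> ('i \<Rightarrow> real) \<Rightarrow> ereal"
  where "omega a c H u R \<delta> y =
    (SUP h\<in>I4 a c H u R. ereal (FMbar u y h - \<delta> * abs_sum a c u R h))"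

definition L_val ::
    "('n::finite \<Rightarrow> 'i \<Rightarrow> real) \<Rightarrow> real ^ 'n \<Rightarrow> 'h set \<Rightarrow> ('h \<Rightarrow> 'i option \<Rightarrow> real) \<Rightarrow> 'n set \<Rightarrow>
      ('i \<Rightarrow> real) \<Rightarrow> ereal"
  where "L_val a c H u R y = Lim at_top (\<lambda>\<delta>. omega a c H u R \<delta> y)"

end

theory Submission
  imports Defs
begin

text \<open>On \<open>Yhat\<close> the optimal value \<open>p = OV\<close> is a finite sublinear function, and the feasible functionals
  of the dual are exactly the linear functionals \<open>\<psi> \<le> p\<close>. So the claim is that for some \<open>e > 0\<close> the
  function \<open>p\<close> has a linear minorant that coincides with it on the whole segment from \<open>b\<close> to
  \<open>b + e d\<close>. It suffices that the value of \<open>p\<close> at the midpoint is at least the average of its values at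
  the ends: a linear minorant touching \<open>p\<close> there, which exists by a Hahn-Banach argument
  (\<open>sublinear_supporting_functional\<close>), then touches \<open>p\<close> at both ends, hence, by convexity of
  \<open>p\<close>, everywhere between.

  The midpoint inequality comes from Fourier-Motzkin elimination. Each final row containing \<open>z\<close>
  is, up to the terms in the remaining variables, a lower bound for the objective which is linear in
  the right-hand side \<open>y\<close>. The coefficients on every remaining variable have one sign, so all
  remaining variables can be pushed to infinity together, and a row matters only in so far as its
  coefficients on them are negligible. Accordingly \<open>p y\<close> is the limit superior of the right-hand
  sides \<open>FMbar u y h\<close> along the filter of rows containing \<open>z\<close> whose remaining coefficients tend to
  \<open>0\<close> (\<open>OV_eq_Limsup\<close>); this combines the functions \<open>S\<close> and \<open>L\<close> into one object.

  The two conditions on sequences of rows say that along this filter the values \<open>FMbar u b h\<close>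
  leave a gap below their limit superior \<open>p b\<close> (\<open>flat_rows_gap\<close>). As \<open>FMbar u d\<close> is bounded, for
  small \<open>e\<close> the rows that nearly attain \<open>p (b + e d)\<close> cannot have \<open>FMbar u b h\<close> below the gap, so
  they nearly attain \<open>p b\<close> too. Evaluated at the midpoint, these rows give the average of the two
  values (\<open>Limsup_midpoint\<close>).\<close>

section \<open>The pairing with multiplier vectors\<close>

lemma fscale_apply [simp]: "(r *\<^sub>F y) i = r * y i"
  by (simp add: fscale_def)

lemma pairing_eq_sum:
  assumes "finite A" and "{s. u s \<noteq> 0} \<subseteq> A"
  shows "pairing v u = (\<Sum>s\<in>A. v s * u s)"
  unfolding pairing_def using assms by (intro sum.mono_neutral_left) auto

lemma pairing_uminus: "pairing (\<lambda>s. - v s) u = - pairing v u"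
  by (simp add: pairing_def sum_negf)

lemma pairing_add_scale:
  assumes "finite {s. u s \<noteq> 0}"
  shows "pairing (\<lambda>s. v s + t * w s) u = pairing v u + t * pairing w u"
  using assms by (simp add: pairing_def sum.distrib sum_distrib_left algebra_simps)

lemma pairing_combination:
  assumes "finite {s. u s \<noteq> 0}" and "finite {s. w s \<noteq> 0}"
  shows "pairing v (\<lambda>s. r * (u s / \<alpha> + w s / \<beta>)) =
    r * (pairing v u / \<alpha> + pairing v w / \<beta>)"
proof -
  let ?A = "{s. u s \<noteq> 0} \<union> {s. w s \<noteq> 0}"
  have "pairing v (\<lambda>s. r * (u s / \<alpha> + w s / \<beta>)) = (\<Sum>s\<in>?A. v s * (r * (u s / \<alpha> + w s / \<beta>)))"
    using assms by (intro pairing_eq_sum) auto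
  also have "\<dots> = r * ((\<Sum>s\<in>?A. v s * u s) / \<alpha> + (\<Sum>s\<in>?A. v s * w s) / \<beta>)"
    by (simp add: sum_distrib_left sum_divide_distrib sum.distrib[symmetric] algebra_simps)
  also have "\<dots> = r * (pairing v u / \<alpha> + pairing v w / \<beta>)"
    using assms by (simp add: pairing_eq_sum[of ?A u] pairing_eq_sum[of ?A w])
  finally show ?thesis .
qed

text \<open>The residuals (left-hand side minus right-hand side) of the original rows at the point \<open>(z, x)\<close>.
  The residual of any derived row is then the pairing of this one vector with the multiplier vector
  of the row, and the row holds at \<open>(z, x)\<close> if and only if that pairing is nonnegative.\<close>

definition slack ::
    "('n::finite \<Rightarrow> 'i \<Rightarrow> real) \<Rightarrow> real ^ 'n \<Rightarrow> ('i \<Rightarrow> real) \<Rightarrow> real \<Rightarrow> real ^ 'n \<Rightarrow> 'i option \<Rightarrow> real"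
  where "slack a c y z x =
    case_option (z - (\<Sum>k\<in>UNIV. c $ k * x $ k)) (\<lambda>i. (\<Sum>k\<in>UNIV. a k i * x $ k) - y i)"

lemma pairing_slack:
  assumes fin: "finite {s. u h s \<noteq> 0}"
  shows "pairing (slack a c y z x) (u h) =
    u h None * z + (\<Sum>k\<in>UNIV. x $ k * a_tilde a c u k h) - FMbar u y h"
proof -
  let ?A = "insert None {s. u h s \<noteq> 0}"
  have fA: "finite ?A" using fin by simp
  have "(\<Sum>k\<in>UNIV. x $ k * a_tilde a c u k h) =
      (\<Sum>k\<in>UNIV. \<Sum>s\<in>?A. x $ k * (case_option (- (c $ k)) (a k) s * u h s))"
    unfolding a_tilde_def var_coeff_def pairing_eq_sum[OF fA subset_insertI]
    by (simp only: sum_distrib_left)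
  also have "\<dots> = (\<Sum>s\<in>?A. \<Sum>k\<in>UNIV. x $ k * (case_option (- (c $ k)) (a k) s * u h s))"
    by (rule sum.swap)
  finally have 1: "(\<Sum>k\<in>UNIV. x $ k * a_tilde a c u k h) =
    (\<Sum>s\<in>?A. \<Sum>k\<in>UNIV. x $ k * (case_option (- (c $ k)) (a k) s * u h s))" .
  have 2: "u h None * z = (\<Sum>s\<in>?A. if s = None then z * u h s else 0)"
    using fA by (simp add: sum.delta)
  have 3: "FMbar u y h = (\<Sum>s\<in>?A. case_option 0 y s * u h s)"
    unfolding FMbar_def by (rule pairing_eq_sum) (use fin in auto)
  have 4: "pairing (slack a c y z x) (u h) = (\<Sum>s\<in>?A. slack a c y z x s * u h s)"
    by (rule pairing_eq_sum) (use fin in auto)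
  show ?thesis unfolding 1 2 3 4 sum.distrib[symmetric] sum_subtractf[symmetric]
  proof (rule sum.cong[OF refl])
    fix s
    show "slack a c y z x s * u h s = (if s = None then z * u h s else 0) +
        (\<Sum>k\<in>UNIV. x $ k * ((case s of None \<Rightarrow> - (c $ k) | Some i \<Rightarrow> a k i) * u h s)) -
        (case s of None \<Rightarrow> 0 | Some i \<Rightarrow> y i) * u h s"
      by (cases s) (simp_all add: slack_def algebra_simps sum_distrib_left sum_distrib_right sum_negf)
  qed
qed

text \<open>Moving \<open>x\<close> along the \<open>j\<close>-th axis changes each residual by a multiple of the coefficient on the
  variable \<open>j\<close>; this is what reduces an elimination step to a problem in one real unknown.\<close>

lemma slack_update:
  "slack a c y z (x + t *\<^sub>R axis j 1) =
    (\<lambda>s. slack a c y z x s + t * case_option (- (c $ j)) (a j) s)"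
proof
  fix s
  have "(\<Sum>k\<in>UNIV. f k * (x + t *\<^sub>R axis j 1) $ k) = (\<Sum>k\<in>UNIV. f k * x $ k) + t * f j" for f
  proof -
    have "(\<Sum>k\<in>UNIV. f k * (x + t *\<^sub>R axis j 1) $ k) =
        (\<Sum>k\<in>UNIV. f k * x $ k + (if k = j then t * f k else 0))"
      by (rule sum.cong) (auto simp: axis_def algebra_simps)
    also have "\<dots> = (\<Sum>k\<in>UNIV. f k * x $ k) + t * f j"
      by (simp add: sum.distrib)
    finally show ?thesis .
  qed
  from this[of "\<lambda>k. c $ k"] this[of "\<lambda>k. a k (the s)"]
  show "slack a c y z (x + t *\<^sub>R axis j 1) s =
      slack a c y z x s + t * case_option (- (c $ j)) (a j) s"
    by (cases s) (simp_all add: slack_def algebra_simps)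
qed

lemma finite_support_multiplier: "finite {s. multiplier a c \<sigma> h s \<noteq> 0}"
proof (induction h)
  case (Comb j p q)
  then show ?case
    by (intro finite_subset[OF _ finite_UnI[OF Comb]]) auto
qed auto

lemma pairing_Comb:
  "pairing v (multiplier a c \<sigma> (Comb j p q)) = \<sigma> (Comb j p q) *
     (pairing v (multiplier a c \<sigma> p) / var_coeff a c j (multiplier a c \<sigma> p) +
      pairing v (multiplier a c \<sigma> q) / \<bar>var_coeff a c j (multiplier a c \<sigma> q)\<bar>)"
  using pairing_combination[OF finite_support_multiplier finite_support_multiplier]
  by simp

lemma FMbar_add_scale:
  assumes "fm_output I a c H u R"
  shows "FMbar u (y + t *\<^sub>F w) h = FMbar u y h + t * FMbar u w h"
proof -
  from assms have fin: "finite {s. u h s \<noteq> 0}"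
    unfolding fm_output_def using finite_support_multiplier by blast
  have "case_option 0 (y + t *\<^sub>F w) = (\<lambda>s. case_option 0 y s + t * case_option 0 w s)"
    by (simp add: fun_eq_iff split: option.split)
  then show ?thesis unfolding FMbar_def by (simp only: pairing_add_scale[OF fin])
qed

section \<open>Fourier-Motzkin elimination\<close>

text \<open>A new row is a positive combination of two old ones, so any linear form in the multiplier vector
  that is nonnegative on the old rows stays nonnegative. With residuals as the form this is the
  soundness of elimination; with plus or minus a coefficient it preserves signs and zeros of
  coefficients.\<close>

lemma fm_step_preserves_nonneg:
  assumes u: "u = multiplier a c \<sigma>" and \<sigma>: "\<And>r. \<sigma> r > 0"
    and nonneg: "\<forall>h\<in>fst st. pairing v (u h) \<ge> 0"
    and h: "h \<in> fst (fm_step u a c j st)"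
  shows "pairing v (u h) \<ge> 0"
proof (cases "h \<in> fst st")
  case False
  then obtain p q where "p \<in> fst st" "q \<in> fst st" "h = Comb j p q"
      "var_coeff a c j (u p) > 0"
    using h by (auto simp: fm_step_def Let_def split: if_splits prod.splits)
  with nonneg show ?thesis
    unfolding u pairing_Comb[of v] \<open>h = _\<close>
    by (intro mult_nonneg_nonneg add_nonneg_nonneg divide_nonneg_nonneg less_imp_le[OF \<sigma>]) auto
qed (use nonneg in blast)

text \<open>Eliminating a variable loses nothing, even with infinitely many rows. The rows with positive
  coefficient bound the step \<open>t\<close> along the axis from below, those with negative coefficient from
  above, and the new rows say that each lower bound is at most each upper bound. As both kinds of
  row occur, the supremum of the lower bounds is a real number that satisfies all bounds.\<close>

lemma fm_step_lift_solution:
  assumes u: "u = multiplier a c \<sigma>" and \<sigma>: "\<And>r. \<sigma> r > 0"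
    and sol: "\<forall>h\<in>fst (fm_step u a c j st). pairing (slack a c y z x) (u h) \<ge> 0"
  shows "\<exists>x'. \<forall>h\<in>fst st. pairing (slack a c y z x') (u h) \<ge> 0"
proof -
  define K where "K = fst st"
  define \<alpha> where "\<alpha> h = var_coeff a c j (u h)" for h
  define v where "v h = pairing (slack a c y z x) (u h)" for h
  have shift: "pairing (slack a c y z (x + t *\<^sub>R axis j 1)) (u h) = v h + t * \<alpha> h" for t h
    unfolding slack_update v_def \<alpha>_def var_coeff_def u
    by (rule pairing_add_scale[OF finite_support_multiplier])
  show ?thesis
  proof (cases "(\<exists>p\<in>K. \<alpha> p > 0) \<and> (\<exists>q\<in>K. \<alpha> q < 0)")
    case False
    then have "fst (fm_step u a c j st) = K"
      by (auto simp: fm_step_def Let_def K_def \<alpha>_def split: prod.splits)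
    with sol show ?thesis by (auto simp: K_def)
  next
    case True
    then have K': "fst (fm_step u a c j st) =
        {h\<in>K. \<alpha> h = 0} \<union> {Comb j p q | p q. p \<in> {p\<in>K. \<alpha> p > 0} \<and> q \<in> {q\<in>K. \<alpha> q < 0}}"
      unfolding fm_step_def Let_def K_def \<alpha>_def by (auto split: prod.splits)
    have zero: "v h \<ge> 0" if "h \<in> K" "\<alpha> h = 0" for h
      using sol that unfolding K' v_def by auto
    have pair: "- v p / \<alpha> p \<le> v q / \<bar>\<alpha> q\<bar>" if "p \<in> K" "\<alpha> p > 0" "q \<in> K" "\<alpha> q < 0" for p q
    proof -
      have "pairing (slack a c y z x) (u (Comb j p q)) \<ge> 0"
        using sol that unfolding K' by auto
      then have "0 \<le> \<sigma> (Comb j p q) * (v p / \<alpha> p + v q / \<bar>\<alpha> q\<bar>)"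
        unfolding u pairing_Comb by (simp add: v_def \<alpha>_def u)
      then show ?thesis using \<sigma>[of "Comb j p q"] by (simp add: zero_le_mult_iff)
    qed
    \<comment> \<open>the largest lower bound; \<open>q0\<close> provides an upper bound, which makes the supremum finite\<close>
    define t where "t = (SUP p\<in>{p\<in>K. \<alpha> p > 0}. - v p / \<alpha> p)"
    from True obtain p0 q0 where pq0: "p0 \<in> K" "\<alpha> p0 > 0" "q0 \<in> K" "\<alpha> q0 < 0" by auto
    have bdd: "bdd_above ((\<lambda>p. - v p / \<alpha> p) ` {p\<in>K. \<alpha> p > 0})"
      using pair[OF _ _ pq0(3,4)] by (auto intro!: bdd_aboveI)
    have lower: "- v p / \<alpha> p \<le> t" if "p \<in> K" "\<alpha> p > 0" for p
      unfolding t_def by (rule cSUP_upper[OF _ bdd]) (use that in auto)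
    have upper: "t \<le> v q / \<bar>\<alpha> q\<bar>" if "q \<in> K" "\<alpha> q < 0" for q
      unfolding t_def by (rule cSUP_least) (use that pq0 pair in auto)
    have "v h + t * \<alpha> h \<ge> 0" if h: "h \<in> K" for h
    proof (cases "\<alpha> h" "0 :: real" rule: linorder_cases)
      case less
      with upper[OF h] show ?thesis by (simp add: field_simps)
    next
      case equal
      with zero[OF h] show ?thesis by simp
    next
      case greater
      with lower[OF h] show ?thesis by (simp add: field_simps)
    qed
    then show ?thesis using shift by (auto simp: K_def intro!: exI[of _ "x + t *\<^sub>R axis j 1"])
  qed
qed

lemma fm_run_snoc: "fm_run I u a c (js @ [j]) = fm_step u a c j (fm_run I u a c js)"
  by (simp add: fm_run_def)

lemma fm_run_preserves_nonneg:
  assumes "u = multiplier a c \<sigma>" and "\<And>r. \<sigma> r > 0"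
    and "\<forall>h\<in>Orig ` insert None (Some ` I). pairing v (u h) \<ge> 0"
  shows "\<forall>h\<in>fst (fm_run I u a c js). pairing v (u h) \<ge> 0"
proof (induction js rule: rev_induct)
  case (snoc j js)
  show ?case unfolding fm_run_snoc
    by (rule ballI) (rule fm_step_preserves_nonneg[OF assms(1,2) snoc])
qed (use assms(3) in \<open>auto simp: fm_run_def\<close>)

lemma fm_run_lift_solution:
  assumes "u = multiplier a c \<sigma>" and "\<And>r. \<sigma> r > 0"
    and "\<forall>h\<in>fst (fm_run I u a c js). pairing (slack a c y z x) (u h) \<ge> 0"
  shows "\<exists>x'. \<forall>h\<in>Orig ` insert None (Some ` I). pairing (slack a c y z x') (u h) \<ge> 0"
  using assms(3)
proof (induction js arbitrary: x rule: rev_induct)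
  case (snoc j js)
  from fm_step_lift_solution[OF assms(1,2) snoc.prems[unfolded fm_run_snoc]]
  obtain x' where "\<forall>h\<in>fst (fm_run I u a c js). pairing (slack a c y z x') (u h) \<ge> 0" ..
  then show ?case by (rule snoc.IH)
qed (auto simp: fm_run_def)

lemma fm_step_preserves_coeff_sign:
  assumes "u = multiplier a c \<sigma>" and "\<And>r. \<sigma> r > 0"
  shows "\<forall>h\<in>fst st. var_coeff a c k (u h) \<ge> 0 \<Longrightarrow>
      \<forall>h\<in>fst (fm_step u a c j st). var_coeff a c k (u h) \<ge> 0"
    and "\<forall>h\<in>fst st. var_coeff a c k (u h) \<le> 0 \<Longrightarrow>
      \<forall>h\<in>fst (fm_step u a c j st). var_coeff a c k (u h) \<le> 0"
proof -
  note keep = fm_step_preserves_nonneg[OF assms, of st]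
  show "\<forall>h\<in>fst st. var_coeff a c k (u h) \<ge> 0 \<Longrightarrow>
      \<forall>h\<in>fst (fm_step u a c j st). var_coeff a c k (u h) \<ge> 0"
    unfolding var_coeff_def by (rule ballI) (rule keep)
  have neg: "var_coeff a c k w \<le> 0 \<longleftrightarrow>
      pairing (\<lambda>s. - case_option (- (c $ k)) (a k) s) w \<ge> 0" for w
    by (simp add: var_coeff_def pairing_uminus)
  show "\<forall>h\<in>fst st. var_coeff a c k (u h) \<le> 0 \<Longrightarrow>
      \<forall>h\<in>fst (fm_step u a c j st). var_coeff a c k (u h) \<le> 0"
    unfolding neg by (rule ballI) (rule keep)
qed

lemma fm_step_eliminates:
  assumes u: "u = multiplier a c \<sigma>"
    and h: "h \<in> fst (fm_step u a c j st)"
    and el: "(\<exists>p\<in>fst st. var_coeff a c j (u p) > 0) \<and> (\<exists>q\<in>fst st. var_coeff a c j (u q) < 0)"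
  shows "var_coeff a c j (u h) = 0"
proof -
  consider "var_coeff a c j (u h) = 0"
    | p q where "h = Comb j p q" "var_coeff a c j (u p) > 0" "var_coeff a c j (u q) < 0"
    using h el unfolding fm_step_def Let_def by (auto split: prod.splits if_splits)
  then show ?thesis
  proof cases
    case 2
    then show ?thesis unfolding u \<open>h = _\<close> var_coeff_def pairing_Comb by simp
  qed
qed

text \<open>A variable that is processed but not eliminated has coefficients of one sign at that moment, and
  positive combinations cannot create the other sign later.\<close>

lemma fm_run_coeff_one_signed:
  assumes u: "u = multiplier a c \<sigma>" and \<sigma>: "\<And>r. \<sigma> r > 0" and "k \<in> set js"
  shows "(\<forall>h\<in>fst (fm_run I u a c js). var_coeff a c k (u h) \<ge> 0) \<or>
    (\<forall>h\<in>fst (fm_run I u a c js). var_coeff a c k (u h) \<le> 0)"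
  using assms(3)
proof (induction js rule: rev_induct)
  case (snoc j js)
  let ?st = "fm_run I u a c js"
  consider "k \<in> set js"
    | "k = j" "(\<exists>p\<in>fst ?st. var_coeff a c j (u p) > 0) \<and> (\<exists>q\<in>fst ?st. var_coeff a c j (u q) < 0)"
    | "k = j" "\<forall>p\<in>fst ?st. var_coeff a c j (u p) \<ge> 0"
    | "k = j" "\<forall>p\<in>fst ?st. var_coeff a c j (u p) \<le> 0"
    using snoc.prems unfolding not_less[symmetric] by auto
  then show ?case
  proof cases
    case 1
    from snoc.IH[OF this] show ?thesis unfolding fm_run_snoc
      by (elim disj_forward fm_step_preserves_coeff_sign[OF u \<sigma>])
  next
    case 2
    then show ?thesis unfolding fm_run_snoc using fm_step_eliminates[OF u _ 2(2)] by auto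
  next
    case 3
    then show ?thesis unfolding fm_run_snoc
      by (intro disjI1 fm_step_preserves_coeff_sign(1)[OF u \<sigma>]) simp
  next
    case 4
    then show ?thesis unfolding fm_run_snoc
      by (intro disjI2 fm_step_preserves_coeff_sign(2)[OF u \<sigma>]) simp
  qed
qed simp

lemma fm_run_eliminated_coeff:
  assumes u: "u = multiplier a c \<sigma>" and \<sigma>: "\<And>r. \<sigma> r > 0"
    and "k \<notin> snd (fm_run I u a c js)" and "h \<in> fst (fm_run I u a c js)"
  shows "var_coeff a c k (u h) = 0"
  using assms(3,4)
proof (induction js arbitrary: h rule: rev_induct)
  case (snoc j js)
  let ?st = "fm_run I u a c js"
  show ?case
  proof (cases "k \<in> snd ?st")
    case True
    then have "k = j \<and> (\<exists>p\<in>fst ?st. var_coeff a c j (u p) > 0) \<and>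
        (\<exists>q\<in>fst ?st. var_coeff a c j (u q) < 0)"
      using snoc.prems(1) unfolding fm_run_snoc fm_step_def Let_def
      by (auto split: prod.splits if_splits)
    then show ?thesis
      using fm_step_eliminates[OF u snoc.prems(2)[unfolded fm_run_snoc]] by simp
  next
    case False
    then have "\<forall>h\<in>fst ?st. var_coeff a c k (u h) = 0" using snoc.IH by blast
    then have "\<forall>h\<in>fst ?st. var_coeff a c k (u h) \<ge> 0" "\<forall>h\<in>fst ?st. var_coeff a c k (u h) \<le> 0"
      by simp_all
    from fm_step_preserves_coeff_sign(1)[OF u \<sigma> this(1)]
      fm_step_preserves_coeff_sign(2)[OF u \<sigma> this(2)]
    show ?thesis
      using snoc.prems(2) unfolding fm_run_snoc by (auto intro: antisym)
  qed
qed (simp add: fm_run_def)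

lemma feasible_set_iff_slack:
  "x \<in> feasible_set I a y \<and> (\<Sum>k\<in>UNIV. c $ k * x $ k) \<le> z \<longleftrightarrow>
    (\<forall>h\<in>Orig ` insert None (Some ` I). pairing (slack a c y z x) (multiplier a c \<sigma> h) \<ge> 0)"
proof -
  have "pairing v (multiplier a c \<sigma> (Orig r)) = v r" for v r
    by (subst pairing_eq_sum[of "{r}"]) auto
  then show ?thesis by (auto simp: feasible_set_def slack_def simp del: multiplier.simps)
qed

text \<open>Every final row is satisfied by the point \<open>(c \<cdot> x, x)\<close>; apart from \<open>z\<close>,
  only the remaining variables contribute to it, and each of them is at most \<open>norm x\<close> in absolute
  value.\<close>

lemma fm_output_row_bound:
  assumes fm: "fm_output I a c H u R" and x: "x \<in> feasible_set I a y" and h: "h \<in> H"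
  shows "FMbar u y h \<le> u h None * (\<Sum>k\<in>UNIV. c $ k * x $ k) + norm x * abs_sum a c u R h"
proof -
  from fm obtain js \<sigma> where run: "(H, R) = fm_run I u a c js" and \<sigma>: "\<And>r. \<sigma> r > 0"
    and u: "u = multiplier a c \<sigma>"
    unfolding fm_output_def by blast
  have fst: "fst (fm_run I u a c js) = H" and snd: "snd (fm_run I u a c js) = R"
    using run by (simp_all flip: run)
  let ?z = "\<Sum>k\<in>UNIV. c $ k * x $ k"
  have "\<forall>h\<in>Orig ` insert None (Some ` I). pairing (slack a c y ?z x) (u h) \<ge> 0"
    unfolding u using x feasible_set_iff_slack[of x I a y c ?z \<sigma>] by blast
  from fm_run_preserves_nonneg[OF u \<sigma> this] h fst
  have "0 \<le> pairing (slack a c y ?z x) (u h)" by blast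
  then have "FMbar u y h \<le> u h None * ?z + (\<Sum>k\<in>UNIV. x $ k * a_tilde a c u k h)"
    by (subst (asm) pairing_slack) (simp_all add: u finite_support_multiplier)
  also have "(\<Sum>k\<in>UNIV. x $ k * a_tilde a c u k h) = (\<Sum>k\<in>R. x $ k * a_tilde a c u k h)"
    using fm_run_eliminated_coeff[OF u \<sigma>, of _ I js h] h fst snd
    by (intro sum.mono_neutral_right) (auto simp: a_tilde_def)
  also have "\<dots> \<le> (\<Sum>k\<in>R. norm x * \<bar>a_tilde a c u k h\<bar>)"
  proof (rule sum_mono)
    fix k
    have "x $ k * a_tilde a c u k h \<le> \<bar>x $ k\<bar> * \<bar>a_tilde a c u k h\<bar>"
      by (metis abs_ge_self abs_mult)
    also have "\<dots> \<le> norm x * \<bar>a_tilde a c u k h\<bar>"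
      by (intro mult_right_mono component_le_norm_cart) simp
    finally show "x $ k * a_tilde a c u k h \<le> norm x * \<bar>a_tilde a c u k h\<bar>" .
  qed
  finally show ?thesis by (simp add: abs_sum_def sum_distrib_left)
qed

text \<open>Since the coefficients on a remaining variable have one sign, setting the variable to \<open>\<delta>\<close> or
  \<open>- \<delta>\<close> accordingly makes it contribute \<open>\<delta>\<close> times the absolute value of the coefficient to every
  row. The final system is thus a system in \<open>z\<close> and the single number \<open>\<delta>\<close>, and its solutions lift
  back through the eliminations.\<close>

lemma fm_output_attains:
  fixes a :: "'n::finite \<Rightarrow> 'i \<Rightarrow> real"
  assumes fm: "fm_output I a c H u R"
    and rows: "\<And>h. h \<in> H \<Longrightarrow> FMbar u y h \<le> u h None * z + \<delta> * abs_sum a c u R h"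
  shows "\<exists>x\<in>feasible_set I a y. (\<Sum>k\<in>UNIV. c $ k * x $ k) \<le> z"
proof -
  from fm obtain js \<sigma> where run: "(H, R) = fm_run I u a c js" and \<sigma>: "\<And>r. \<sigma> r > 0"
    and u: "u = multiplier a c \<sigma>" and js: "set js = UNIV"
    unfolding fm_output_def by blast
  have fst: "fst (fm_run I u a c js) = H" and snd: "snd (fm_run I u a c js) = R"
    using run by (simp_all flip: run)
  define x :: "real ^ 'n" where "x = (\<chi> k. if \<forall>h\<in>H. var_coeff a c k (u h) \<ge> 0 then \<delta> else - \<delta>)"
  have x: "x $ k * a_tilde a c u k h = \<delta> * \<bar>a_tilde a c u k h\<bar>" if "h \<in> H" for h k
  proof -
    have "(\<forall>h\<in>H. var_coeff a c k (u h) \<ge> 0) \<or> (\<forall>h\<in>H. var_coeff a c k (u h) \<le> 0)"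
      using fm_run_coeff_one_signed[OF u \<sigma>, of k js I] js fst by auto
    with that show ?thesis unfolding x_def a_tilde_def by auto
  qed
  have "pairing (slack a c y z x) (u h) \<ge> 0" if h: "h \<in> H" for h
  proof -
    have "(\<Sum>k\<in>UNIV. x $ k * a_tilde a c u k h) = (\<Sum>k\<in>R. x $ k * a_tilde a c u k h)"
      using fm_run_eliminated_coeff[OF u \<sigma>, of _ I js h] h fst snd
      by (intro sum.mono_neutral_right) (auto simp: a_tilde_def)
    also have "\<dots> = \<delta> * abs_sum a c u R h"
      by (simp add: x[OF h] abs_sum_def sum_distrib_left)
    finally show ?thesis
      using rows[OF h] by (subst pairing_slack) (simp_all add: u finite_support_multiplier)
  qed
  then obtain x' where "\<forall>h\<in>Orig ` insert None (Some ` I). pairing (slack a c y z x') (u h) \<ge> 0"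
    using fm_run_lift_solution[OF u \<sigma>, of I js] fst by blast
  then show ?thesis
    unfolding u using feasible_set_iff_slack[of x' I a y c z \<sigma>] by blast
qed

section \<open>The optimal value as a limit superior over flat rows\<close>

lemma abs_sum_nonneg: "abs_sum a c u R h \<ge> 0"
  by (simp add: abs_sum_def sum_nonneg)

text \<open>The rows containing \<open>z\<close>, in the limit where the coefficients on the remaining variables tend to
  \<open>0\<close>. The rows in \<^const>\<open>I3\<close>, whose coefficients are all \<open>0\<close>, lie in every neighbourhood, so that
  a limit superior along this filter covers both \<^const>\<open>S_val\<close> and \<^const>\<open>L_val\<close>.\<close>

definition flat_rows ::
    "('n::finite \<Rightarrow> 'i \<Rightarrow> real) \<Rightarrow> real ^ 'n \<Rightarrow> 'h set \<Rightarrow> ('h \<Rightarrow> 'i option \<Rightarrow> real) \<Rightarrow> 'n set \<Rightarrow> 'h filter"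
  where "flat_rows a c H u R =
    inf (filtercomap (abs_sum a c u R) (nhds 0)) (principal {h \<in> H. u h None = 1})"

lemma eventually_flat_rows:
  "eventually P (flat_rows a c H u R) \<longleftrightarrow>
    (\<exists>\<eta>>0. \<forall>h\<in>H. u h None = 1 \<longrightarrow> abs_sum a c u R h < \<eta> \<longrightarrow> P h)"
  unfolding flat_rows_def eventually_inf_principal eventually_filtercomap eventually_nhds_metric
proof safe
  fix Q e assume "0 < e" "\<forall>x. dist x 0 < e \<longrightarrow> Q x"
    "\<forall>h. Q (abs_sum a c u R h) \<longrightarrow> h \<in> {h \<in> H. u h None = 1} \<longrightarrow> P h"
  then show "\<exists>\<eta>>0. \<forall>h\<in>H. u h None = 1 \<longrightarrow> abs_sum a c u R h < \<eta> \<longrightarrow> P h"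
    by (auto intro!: exI[of _ e] simp: dist_real_def abs_sum_nonneg)
next
  fix \<eta> :: real assume "\<eta> > 0" "\<forall>h\<in>H. u h None = 1 \<longrightarrow> abs_sum a c u R h < \<eta> \<longrightarrow> P h"
  then show "\<exists>Q. (\<exists>d>0. \<forall>x. dist x 0 < d \<longrightarrow> Q x) \<and>
      (\<forall>h. Q (abs_sum a c u R h) \<longrightarrow> h \<in> {h \<in> H. u h None = 1} \<longrightarrow> P h)"
    by (intro exI[of _ "\<lambda>x. \<bar>x\<bar> < \<eta>"]) (auto simp: dist_real_def abs_sum_nonneg)
qed

lemma Limsup_eq_ereal_iff:
  "Limsup F (\<lambda>h. ereal (f h)) = ereal v \<longleftrightarrow>
    (\<forall>e>0. (\<forall>\<^sub>F h in F. f h < v + e) \<and> (\<exists>\<^sub>F h in F. f h > v - e))"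
proof
  assume v: "Limsup F (\<lambda>h. ereal (f h)) = ereal v"
  show "\<forall>e>0. (\<forall>\<^sub>F h in F. f h < v + e) \<and> (\<exists>\<^sub>F h in F. f h > v - e)"
  proof (intro allI impI conjI)
    fix e :: real assume e: "e > 0"
    show "\<forall>\<^sub>F h in F. f h < v + e"
      using Limsup_lessD[of F "\<lambda>h. ereal (f h)" "ereal (v + e)"] v e by simp
    show "\<exists>\<^sub>F h in F. f h > v - e"
    proof (rule ccontr)
      assume "\<not> ?thesis"
      then have "\<forall>\<^sub>F h in F. ereal (f h) \<le> ereal (v - e)"
        by (simp add: not_frequently not_less)
      from Limsup_bounded[OF this] v e show False by simp
    qed
  qed
next
  assume lim: "\<forall>e>0. (\<forall>\<^sub>F h in F. f h < v + e) \<and> (\<exists>\<^sub>F h in F. f h > v - e)"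
  have "Limsup F (\<lambda>h. ereal (f h)) \<le> ereal v + ereal e" if "e > 0" for e
    using lim that by (intro Limsup_bounded) (auto elim!: eventually_mono)
  then have "Limsup F (\<lambda>h. ereal (f h)) \<le> ereal v"
    by (rule ereal_le_epsilon2)
  moreover have "\<not> Limsup F (\<lambda>h. ereal (f h)) < ereal v"
  proof
    assume "Limsup F (\<lambda>h. ereal (f h)) < ereal v"
    then obtain r where r: "Limsup F (\<lambda>h. ereal (f h)) < ereal r" "r < v"
      using ereal_dense2[of _ "ereal v"] by auto
    from Limsup_lessD[OF r(1)] have ev: "\<forall>\<^sub>F h in F. f h < r" by simp
    have "\<exists>\<^sub>F h in F. f h > r" using lim[rule_format, of "v - r"] r(2) by simp
    from frequently_eventually_frequently[OF this ev] show False by (auto simp: frequently_def)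
  qed
  ultimately show "Limsup F (\<lambda>h. ereal (f h)) = ereal v" by (simp add: antisym not_less)
qed

lemma OV_le: "x \<in> feasible_set I a y \<Longrightarrow> OV I a c y \<le> ereal (\<Sum>k\<in>UNIV. c $ k * x $ k)"
  unfolding OV_def by (rule INF_lower)

lemma OV_less_obtain:
  assumes "OV I a c y < ereal z"
  obtains x where "x \<in> feasible_set I a y" "(\<Sum>k\<in>UNIV. c $ k * x $ k) < z"
  using assms unfolding OV_def by (auto simp: INF_less_iff)

text \<open>A row with small \<open>abs_sum\<close> bounds the value of every fixed feasible point from below up to a
  small error; this gives the upper estimate. Conversely, if the right-hand sides of all rows with
  \<open>abs_sum\<close> below \<open>\<eta>\<close> were at most \<open>v - e\<close>, then a large \<open>\<delta>\<close> would satisfy the other rows containing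
  \<open>z\<close> as well, because the right-hand sides are bounded, and also the rows without \<open>z\<close>, which hold
  for large \<open>\<delta>\<close> by feasibility. The value \<open>v - e\<close> would then be attained.\<close>

lemma OV_eq_Limsup:
  assumes fm: "fm_output I a c H u R" and v: "OV I a c y = ereal v"
    and bdd: "FMbar u y \<in> linf H"
  shows "Limsup (flat_rows a c H u R) (\<lambda>h. ereal (FMbar u y h)) = ereal v"
  unfolding Limsup_eq_ereal_iff
proof (intro allI impI conjI)
  fix e :: real assume e: "e > 0"
  from e v have "OV I a c y < ereal (v + e / 2)" by simp
  then obtain x where x: "x \<in> feasible_set I a y" "(\<Sum>k\<in>UNIV. c $ k * x $ k) < v + e / 2"
    by (rule OV_less_obtain)
  show "\<forall>\<^sub>F h in flat_rows a c H u R. FMbar u y h < v + e"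
    unfolding eventually_flat_rows
  proof (intro exI conjI ballI impI)
    show "e / 2 / (norm x + 1) > 0" using e by (simp add: add_nonneg_pos)
    fix h assume h: "h \<in> H" "u h None = 1" "abs_sum a c u R h < e / 2 / (norm x + 1)"
    have "norm x * abs_sum a c u R h \<le> (norm x + 1) * abs_sum a c u R h"
      by (simp add: mult_right_mono abs_sum_nonneg)
    also have "\<dots> < e / 2"
      using h(3) pos_less_divide_eq[of "norm x + 1" "abs_sum a c u R h" "e / 2"]
      by (simp only: mult.commute add_nonneg_pos[OF norm_ge_zero zero_less_one])
    finally show "FMbar u y h < v + e"
      using fm_output_row_bound[OF fm x(1) h(1)] h(2) x(2) by simp
  qed
  show "\<exists>\<^sub>F h in flat_rows a c H u R. FMbar u y h > v - e"
  proof (rule ccontr)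
    assume "\<not> ?thesis"
    then obtain \<eta> where \<eta>: "\<eta> > 0"
        "\<And>h. h \<in> H \<Longrightarrow> u h None = 1 \<Longrightarrow> abs_sum a c u R h < \<eta> \<Longrightarrow> FMbar u y h \<le> v - e"
      by (auto simp: not_frequently eventually_flat_rows not_less)
    from bdd obtain B where B: "\<And>h. h \<in> H \<Longrightarrow> \<bar>FMbar u y h\<bar> \<le> B"
      by (auto simp: linf_def bounded_iff)
    \<comment> \<open>\<open>norm x\<close> takes care of the rows without \<open>z\<close>, the quotient of those with \<open>abs_sum\<close> at least \<open>\<eta>\<close>\<close>
    define \<delta> where "\<delta> = max (norm x) (\<bar>B - (v - e)\<bar> / \<eta>)"
    have \<delta>0: "\<delta> \<ge> 0" unfolding \<delta>_def by (rule max.coboundedI1) (rule norm_ge_zero)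
    have "\<exists>x\<in>feasible_set I a y. (\<Sum>k\<in>UNIV. c $ k * x $ k) \<le> v - e"
    proof (rule fm_output_attains[OF fm, of y _ \<delta>])
      fix h assume h: "h \<in> H"
      let ?s = "abs_sum a c u R h"
      consider "u h None = 0" | "u h None = 1"
        using fm h unfolding fm_output_def by blast
      then show "FMbar u y h \<le> u h None * (v - e) + \<delta> * ?s"
      proof cases
        case 1
        have "norm x * ?s \<le> \<delta> * ?s"
          by (intro mult_right_mono) (simp_all add: \<delta>_def abs_sum_nonneg)
        with fm_output_row_bound[OF fm x(1) h] 1 show ?thesis by simp
      next
        case 2
        show ?thesis
        proof (cases "?s < \<eta>")
          case True
          have "\<delta> * ?s \<ge> 0" by (intro mult_nonneg_nonneg \<delta>0 abs_sum_nonneg)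
          with \<eta>(2)[OF h 2 True] 2 show ?thesis by simp
        next
          case False
          have "\<bar>B - (v - e)\<bar> \<le> \<delta> * \<eta>"
            using \<eta>(1) unfolding \<delta>_def by (simp add: max_def field_simps)
          also have "\<dots> \<le> \<delta> * ?s" using False \<delta>0 by (intro mult_left_mono) auto
          finally show ?thesis using B[OF h] 2 by simp
        qed
      qed
    qed
    then obtain x where "x \<in> feasible_set I a y" "(\<Sum>k\<in>UNIV. c $ k * x $ k) \<le> v - e" by blast
    with OV_le[of x I a y c] v e show False by simp
  qed
qed

section \<open>The gap below the optimal value\<close>

lemma L_val_eq_INF:
  "L_val a c H u R y = (INF \<delta>. omega a c H u R \<delta> y)"
proof -
  have mono: "omega a c H u R \<delta>' y \<le> omega a c H u R \<delta> y" if "\<delta> \<le> \<delta>'" for \<delta> \<delta>'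
    unfolding omega_def by (rule SUP_mono') (simp add: mult_right_mono that abs_sum_nonneg)
  have "((\<lambda>\<delta>. omega a c H u R \<delta> y) \<longlongrightarrow> (INF \<delta>. omega a c H u R \<delta> y)) at_top"
  proof (rule decreasing_tendsto)
    show "\<forall>\<^sub>F \<delta> in at_top. (INF \<delta>. omega a c H u R \<delta> y) \<le> omega a c H u R \<delta> y"
      by (intro always_eventually allI INF_lower UNIV_I)
    fix z assume "(INF \<delta>. omega a c H u R \<delta> y) < z"
    then obtain \<delta> where "omega a c H u R \<delta> y < z" by (auto simp: INF_less_iff)
    then show "\<forall>\<^sub>F \<delta> in at_top. omega a c H u R \<delta> y < z"
      using eventually_mono[OF eventually_ge_at_top[of \<delta>]] order.strict_trans1[OF mono] by simp
  qed
  then show ?thesis unfolding L_val_def by (intro tendsto_Lim) auto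
qed

lemma L_val_le_OV:
  assumes fm: "fm_output I a c H u R"
  shows "L_val a c H u R y \<le> OV I a c y"
  unfolding OV_def
proof (rule INF_greatest)
  fix x assume x: "x \<in> feasible_set I a y"
  have "L_val a c H u R y \<le> omega a c H u R (norm x) y"
    unfolding L_val_eq_INF by (rule INF_lower) simp
  also have "\<dots> \<le> ereal (\<Sum>k\<in>UNIV. c $ k * x $ k)"
    unfolding omega_def
  proof (rule SUP_least)
    fix h assume "h \<in> I4 a c H u R"
    with fm_output_row_bound[OF fm x, of h]
    show "ereal (FMbar u y h - norm x * abs_sum a c u R h) \<le> ereal (\<Sum>k\<in>UNIV. c $ k * x $ k)"
      by (simp add: I4_def)
  qed
  finally show "L_val a c H u R y \<le> ereal (\<Sum>k\<in>UNIV. c $ k * x $ k)" .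
qed

lemma S_val_le_OV:
  assumes fm: "fm_output I a c H u R"
  shows "S_val a c H u y \<le> OV I a c y"
  unfolding OV_def S_val_def
proof (intro INF_greatest SUP_least)
  fix x h assume x: "x \<in> feasible_set I a y" and "h \<in> I3 a c H u"
  with fm_output_row_bound[OF fm x, of h]
  show "ereal (FMbar u y h) \<le> ereal (\<Sum>k\<in>UNIV. c $ k * x $ k)"
    by (simp add: I3_def abs_sum_def)
qed

text \<open>A right-hand side below \<open>S b\<close> is the limit superior of a constant sequence, so the first condition
  keeps all of them away from \<open>S b\<close>.\<close>

lemma I3_gap:
  fixes u :: "'h \<Rightarrow> 'i option \<Rightarrow> real"
  assumes le: "S_val a c H u b \<le> ereal v"
    and DP1: "I3 a c H u \<noteq> {} \<Longrightarrow>
      (SUP h \<in> {h :: nat \<Rightarrow> 'h. range h \<subseteq> I3 a c H u \<and>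
                  limsup (\<lambda>m. ereal (FMbar u b (h m))) < S_val a c H u b}.
         limsup (\<lambda>m. ereal (FMbar u b (h m)))) < S_val a c H u b"
  shows "\<exists>\<sigma><v. \<forall>h\<in>I3 a c H u. FMbar u b h > \<sigma> \<longrightarrow> FMbar u b h \<ge> v"
proof -
  have S: "ereal (FMbar u b h) \<le> S_val a c H u b" if "h \<in> I3 a c H u" for h
    unfolding S_val_def using that by (rule SUP_upper)
  consider "I3 a c H u = {}" | "S_val a c H u b < ereal v"
    | "I3 a c H u \<noteq> {}" "S_val a c H u b = ereal v"
    using le by force
  then show ?thesis
  proof cases
    case 1
    then show ?thesis by (auto intro: exI[of _ "v - 1"])
  next
    case 2
    then obtain \<sigma> where \<sigma>: "S_val a c H u b < ereal \<sigma>" "\<sigma> < v"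
      using ereal_dense2[of _ "ereal v"] by auto
    have "FMbar u b h < \<sigma>" if "h \<in> I3 a c H u" for h
      using order.strict_trans1[OF S[OF that] \<sigma>(1)] by simp
    with \<sigma>(2) show ?thesis by (force intro: exI[of _ \<sigma>])
  next
    case 3
    let ?X = "{h :: nat \<Rightarrow> 'h. range h \<subseteq> I3 a c H u \<and>
                  limsup (\<lambda>m. ereal (FMbar u b (h m))) < S_val a c H u b}"
    from DP1[OF 3(1)] obtain \<sigma> where
      \<sigma>: "(SUP h\<in>?X. limsup (\<lambda>m. ereal (FMbar u b (h m)))) < ereal \<sigma>" "\<sigma> < v"
      unfolding 3(2) using ereal_dense2[of _ "ereal v"] by auto
    have "FMbar u b h \<le> \<sigma>" if h: "h \<in> I3 a c H u" "FMbar u b h < v" for h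
    proof -
      have lim: "limsup (\<lambda>m::nat. ereal (FMbar u b h)) = ereal (FMbar u b h)"
        by (simp add: Limsup_const)
      then have "(\<lambda>_. h) \<in> ?X" using h 3(2) by auto
      from SUP_upper[OF this, of "\<lambda>h. limsup (\<lambda>m. ereal (FMbar u b (h m)))"] \<sigma>(1)
      have "limsup (\<lambda>m::nat. ereal (FMbar u b h)) < ereal \<sigma>" by (rule order.strict_trans1)
      then show ?thesis unfolding lim by simp
    qed
    with \<sigma>(2) show ?thesis by (force intro: exI[of _ \<sigma>])
  qed
qed

text \<open>If the limit of \<open>omega\<close> is below \<open>v\<close>, then so are the right-hand sides of all rows with small
  \<open>abs_sum\<close>, uniformly. Otherwise rows that violate the claim for smaller and smaller \<open>\<eta>\<close> would
  form a sequence of the kind considered in the second condition, with a limit superior above the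
  bound that the condition imposes.\<close>

lemma I4_gap:
  fixes u :: "'h \<Rightarrow> 'i option \<Rightarrow> real"
  assumes le: "L_val a c H u R b \<le> ereal v"
    and DP2: "I4 a c H u R \<noteq> {} \<Longrightarrow>
      (SUP h \<in> {h :: nat \<Rightarrow> 'h. range h \<subseteq> I4 a c H u R \<and>
                  limsup (\<lambda>m. ereal (FMbar u b (h m))) < L_val a c H u R b \<and>
                  (\<lambda>m. abs_sum a c u R (h m)) \<longlonglongrightarrow> 0}.
         limsup (\<lambda>m. ereal (FMbar u b (h m)))) < L_val a c H u R b"
  shows "\<exists>\<sigma><v. \<forall>k>0. \<exists>\<eta>>0. \<forall>h\<in>I4 a c H u R. abs_sum a c u R h < \<eta> \<longrightarrow>
    FMbar u b h > \<sigma> \<longrightarrow> FMbar u b h > v - k"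
proof -
  let ?s = "abs_sum a c u R"
  consider "I4 a c H u R = {}" | "L_val a c H u R b < ereal v"
    | "I4 a c H u R \<noteq> {}" "L_val a c H u R b = ereal v"
    using le by force
  then show ?thesis
  proof cases
    case 1
    then show ?thesis by (intro exI[of _ "v - 1"]) (auto intro: exI[of _ 1])
  next
    case 2
    then obtain \<sigma>' where \<sigma>': "L_val a c H u R b < ereal \<sigma>'" "\<sigma>' < v"
      using ereal_dense2[of _ "ereal v"] by auto
    then obtain \<delta> where \<delta>: "omega a c H u R \<delta> b < ereal \<sigma>'"
      unfolding L_val_eq_INF by (auto simp: INF_less_iff)
    define \<sigma> where "\<sigma> = (\<sigma>' + v) / 2"
    define \<eta> where "\<eta> = (\<sigma> - \<sigma>') / (\<bar>\<delta>\<bar> + 1)"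
    have pos: "\<bar>\<delta>\<bar> + 1 > 0" "\<sigma> - \<sigma>' > 0" "\<sigma> < v" using \<sigma>'(2) by (simp_all add: \<sigma>_def)
    then have "\<eta> > 0" by (simp add: \<eta>_def)
    have "FMbar u b h \<le> \<sigma>" if h: "h \<in> I4 a c H u R" "?s h < \<eta>" for h
    proof -
      have "ereal (FMbar u b h - \<delta> * ?s h) \<le> omega a c H u R \<delta> b"
        unfolding omega_def using h(1) by (rule SUP_upper)
      from order.strict_trans1[OF this \<delta>] have "FMbar u b h < \<sigma>' + \<delta> * ?s h" by simp
      moreover have "\<delta> * ?s h \<le> (\<bar>\<delta>\<bar> + 1) * ?s h"
        by (intro mult_right_mono abs_sum_nonneg) simp
      moreover have "(\<bar>\<delta>\<bar> + 1) * ?s h < \<sigma> - \<sigma>'"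
        using h(2) pos(1) by (simp add: \<eta>_def pos_less_divide_eq mult.commute)
      ultimately show ?thesis by linarith
    qed
    then have "\<forall>h\<in>I4 a c H u R. ?s h < \<eta> \<longrightarrow> FMbar u b h > \<sigma> \<longrightarrow> FMbar u b h > v - k" for k
      unfolding not_less[symmetric] by blast
    with \<open>\<eta> > 0\<close> \<open>\<sigma> < v\<close> show ?thesis by blast
  next
    case 3
    let ?X = "{h :: nat \<Rightarrow> 'h. range h \<subseteq> I4 a c H u R \<and>
                  limsup (\<lambda>m. ereal (FMbar u b (h m))) < L_val a c H u R b \<and>
                  (\<lambda>m. ?s (h m)) \<longlonglongrightarrow> 0}"
    from DP2[OF 3(1)] obtain \<sigma> where
      \<sigma>: "(SUP h\<in>?X. limsup (\<lambda>m. ereal (FMbar u b (h m)))) < ereal \<sigma>" "\<sigma> < v"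
      unfolding 3(2) using ereal_dense2[of _ "ereal v"] by auto
    have "\<exists>\<eta>>0. \<forall>h\<in>I4 a c H u R. ?s h < \<eta> \<longrightarrow> FMbar u b h > \<sigma> \<longrightarrow> FMbar u b h > v - k"
      if k: "k > 0" for k
    proof (rule ccontr)
      assume none: "\<not> ?thesis"
      have "\<exists>h\<in>I4 a c H u R. ?s h < inverse (real (Suc m)) \<and> FMbar u b h > \<sigma> \<and> FMbar u b h \<le> v - k"
        for m
      proof -
        have "inverse (real (Suc m)) > 0" by simp
        with none show ?thesis unfolding not_less[symmetric] by blast
      qed
      then obtain h where h: "\<And>m. h m \<in> I4 a c H u R" "\<And>m. ?s (h m) < inverse (real (Suc m))"
          "\<And>m. FMbar u b (h m) > \<sigma>" "\<And>m. FMbar u b (h m) \<le> v - k"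
        by metis
      have "limsup (\<lambda>m. ereal (FMbar u b (h m))) \<le> ereal (v - k)"
        by (rule Limsup_bounded) (simp add: h)
      moreover have "(\<lambda>m. ?s (h m)) \<longlonglongrightarrow> 0"
        by (rule tendsto_sandwich[OF _ _ tendsto_const LIMSEQ_inverse_real_of_nat])
          (auto intro!: always_eventually simp: abs_sum_nonneg less_imp_le[OF h(2)] simp del: of_nat_Suc)
      ultimately have "h \<in> ?X" using h(1) k 3(2) by (auto intro: order.strict_trans1)
      from SUP_upper[OF this, of "\<lambda>h. limsup (\<lambda>m. ereal (FMbar u b (h m)))"] \<sigma>(1)
      have "limsup (\<lambda>m. ereal (FMbar u b (h m))) < ereal \<sigma>" by (rule order.strict_trans1)
      from Limsup_lessD[OF this] have "\<forall>\<^sub>F m in sequentially. FMbar u b (h m) < \<sigma>" by simp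
      then have "\<exists>m. FMbar u b (h m) < \<sigma>" by (auto dest: eventually_happens)
      with h(3) show False by (meson less_asym)
    qed
    with \<sigma>(2) show ?thesis by blast
  qed
qed

text \<open>Along the filter, the right-hand sides for \<open>b\<close> are at most \<open>\<sigma>\<close> or come close to the optimal value
  \<open>v\<close>: no limit point lies strictly between \<open>\<sigma>\<close> and \<open>v\<close>. This is the only form in which the two
  conditions enter the proof.\<close>

lemma flat_rows_gap:
  fixes a :: "'n::finite \<Rightarrow> 'i \<Rightarrow> real"
  assumes fm: "fm_output I a c H u R" and v: "OV I a c b = ereal v"
    and DP1: "I3 a c H u \<noteq> {} \<Longrightarrow>
      (SUP h \<in> {h :: nat \<Rightarrow> ('i, 'n) fm_row. range h \<subseteq> I3 a c H u \<and>
                  limsup (\<lambda>m. ereal (FMbar u b (h m))) < S_val a c H u b}.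
         limsup (\<lambda>m. ereal (FMbar u b (h m)))) < S_val a c H u b"
    and DP2: "I4 a c H u R \<noteq> {} \<Longrightarrow>
      (SUP h \<in> {h :: nat \<Rightarrow> ('i, 'n) fm_row. range h \<subseteq> I4 a c H u R \<and>
                  limsup (\<lambda>m. ereal (FMbar u b (h m))) < L_val a c H u R b \<and>
                  (\<lambda>m. abs_sum a c u R (h m)) \<longlonglongrightarrow> 0}.
         limsup (\<lambda>m. ereal (FMbar u b (h m)))) < L_val a c H u R b"
  shows "\<exists>\<sigma><v. \<forall>k>0. \<forall>\<^sub>F h in flat_rows a c H u R. FMbar u b h > \<sigma> \<longrightarrow> FMbar u b h > v - k"
proof -
  from I3_gap[OF _ DP1] S_val_le_OV[OF fm] v obtain \<sigma>3 where \<sigma>3: "\<sigma>3 < v"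
      "\<And>h. h \<in> I3 a c H u \<Longrightarrow> FMbar u b h > \<sigma>3 \<Longrightarrow> FMbar u b h \<ge> v"
    by metis
  from I4_gap[OF _ DP2] L_val_le_OV[OF fm] v obtain \<sigma>4 where \<sigma>4: "\<sigma>4 < v"
      "\<And>k. k > 0 \<Longrightarrow> \<exists>\<eta>>0. \<forall>h\<in>I4 a c H u R. abs_sum a c u R h < \<eta> \<longrightarrow>
        FMbar u b h > \<sigma>4 \<longrightarrow> FMbar u b h > v - k"
    by metis
  have split: "h \<in> I3 a c H u \<union> I4 a c H u R" if h: "h \<in> H" "u h None = 1" for h
  proof (cases "abs_sum a c u R h > 0")
    case False
    then have "abs_sum a c u R h = 0" using abs_sum_nonneg[of a c u R h] by simp
    then have "a_tilde a c u k h = 0" if "k \<in> R" for k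
      using that by (simp add: abs_sum_def sum_nonneg_eq_0_iff)
    moreover have "a_tilde a c u k h = 0" if "k \<notin> R" for k
    proof -
      from fm obtain js \<sigma> where run: "(H, R) = fm_run I u a c js" and \<sigma>: "\<And>r. \<sigma> r > 0"
        and u: "u = multiplier a c \<sigma>"
        unfolding fm_output_def by blast
      from fm_run_eliminated_coeff[OF u \<sigma>, of k I js h] that h(1) show ?thesis
        unfolding a_tilde_def run[symmetric] by simp
    qed
    ultimately show ?thesis using h by (auto simp: I3_def)
  qed (use h in \<open>auto simp: I4_def\<close>)
  show ?thesis
  proof (intro exI[of _ "max \<sigma>3 \<sigma>4"] conjI allI impI)
    fix k :: real assume k: "k > 0"
    from \<sigma>4(2)[OF k] obtain \<eta> where \<eta>: "\<eta> > 0" "\<And>h. h \<in> I4 a c H u R \<Longrightarrow>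
        abs_sum a c u R h < \<eta> \<Longrightarrow> FMbar u b h > \<sigma>4 \<Longrightarrow> FMbar u b h > v - k"
      by blast
    show "\<forall>\<^sub>F h in flat_rows a c H u R. FMbar u b h > max \<sigma>3 \<sigma>4 \<longrightarrow> FMbar u b h > v - k"
      unfolding eventually_flat_rows
    proof (intro exI[of _ \<eta>] conjI ballI impI)
      fix h assume h: "h \<in> H" "u h None = 1" "abs_sum a c u R h < \<eta>" "max \<sigma>3 \<sigma>4 < FMbar u b h"
      with split[OF h(1,2)] \<sigma>3(2)[of h] \<eta>(2)[of h] k show "FMbar u b h > v - k" by auto
    qed (fact \<eta>(1))
  qed (use \<sigma>3(1) \<sigma>4(1) in auto)
qed

section \<open>Midpoints of perturbed limits superior\<close>

text \<open>Points where \<open>f + e g\<close> is close to its limit superior \<open>v1\<close> have \<open>f\<close> above \<open>\<sigma>\<close>, because \<open>e\<close> is small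
  compared with the gap. By the gap property \<open>f\<close> is then close to \<open>v0\<close> itself, so the same points
  nearly attain both suprema, and the average of the two values is nearly attained by
  \<open>f + (e / 2) g\<close>.\<close>

lemma Limsup_midpoint:
  fixes f g :: "'h \<Rightarrow> real"
  assumes v0: "Limsup F (\<lambda>h. ereal (f h)) = ereal v0"
    and v1: "Limsup F (\<lambda>h. ereal (f h + e * g h)) = ereal v1"
    and vm: "Limsup F (\<lambda>h. ereal (f h + e / 2 * g h)) = ereal vm"
    and bdd: "\<forall>\<^sub>F h in F. \<bar>g h\<bar> \<le> M" and e: "e > 0" "2 * e * M < v0 - \<sigma>"
    and gap: "\<And>k. k > 0 \<Longrightarrow> \<forall>\<^sub>F h in F. f h > \<sigma> \<longrightarrow> f h > v0 - k"
  shows "(v0 + v1) / 2 \<le> vm"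
proof (rule field_le_epsilon)
  note lim0 = v0[unfolded Limsup_eq_ereal_iff, rule_format]
    and lim1 = v1[unfolded Limsup_eq_ereal_iff, rule_format]
    and limm = vm[unfolded Limsup_eq_ereal_iff, rule_format]
  have eg: "\<bar>e * g h\<bar> \<le> e * M" if "\<bar>g h\<bar> \<le> M" for h
    using that e by (simp add: abs_mult)
  \<comment> \<open>A perturbation of size at most \<open>e * M\<close> moves the limit superior by at most that much.\<close>
  have v1_ge: "v1 \<ge> v0 - e * M"
  proof (rule field_le_epsilon)
    fix k :: real assume k: "k > 0"
    have "\<forall>\<^sub>F h in F. \<bar>g h\<bar> \<le> M \<and> f h + e * g h < v1 + k / 2"
      using bdd lim1[of "k / 2"] k by (auto intro: eventually_conj)
    with lim0[of "k / 2"] k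
    have "\<exists>\<^sub>F h in F. f h > v0 - k / 2 \<and> \<bar>g h\<bar> \<le> M \<and> f h + e * g h < v1 + k / 2"
      by (auto intro: frequently_eventually_frequently)
    then obtain h where "f h > v0 - k / 2" "\<bar>g h\<bar> \<le> M" "f h + e * g h < v1 + k / 2"
      by (blast dest: frequently_ex)
    with eg[of h] show "v0 - e * M \<le> v1 + k" by linarith
  qed
  fix k :: real assume k: "k > 0"
  define k' where "k' = min (k / 4) (v0 - \<sigma> - 2 * e * M)"
  have k': "k' > 0" "k' \<le> k / 4" "k' \<le> v0 - \<sigma> - 2 * e * M"
    using k e(2) unfolding k'_def by (simp_all only: min_less_iff_conj min.cobounded1 min.cobounded2) simp
  have "\<forall>\<^sub>F h in F. \<bar>g h\<bar> \<le> M \<and> (f h > \<sigma> \<longrightarrow> f h > v0 - k') \<and> f h + e / 2 * g h < vm + k'"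
    using bdd gap[of k'] limm[of k'] k'(1) by (auto intro: eventually_conj)
  with lim1[of k'] k'(1)
  have "\<exists>\<^sub>F h in F. f h + e * g h > v1 - k' \<and> \<bar>g h\<bar> \<le> M \<and>
      (f h > \<sigma> \<longrightarrow> f h > v0 - k') \<and> f h + e / 2 * g h < vm + k'"
    by (auto intro: frequently_eventually_frequently)
  then obtain h where h: "f h + e * g h > v1 - k'" "\<bar>g h\<bar> \<le> M"
      "f h > \<sigma> \<longrightarrow> f h > v0 - k'" "f h + e / 2 * g h < vm + k'"
    by (blast dest: frequently_ex)
  have "f h > \<sigma>" using h(1) eg[OF h(2)] v1_ge k'(3) by linarith
  with h have "f h > v0 - k'" by blast
  from add_strict_mono[OF this h(1)]
  have "(v0 - k') + (v1 - k') < 2 * (f h + e / 2 * g h)" by (simp add: field_simps)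
  also have "\<dots> < 2 * (vm + k')" using h(4) by simp
  finally show "(v0 + v1) / 2 \<le> vm + k" using k' k by (simp add: field_simps)
qed

section \<open>Supporting functionals of sublinear functions\<close>

definition sublinear_on :: "('i \<Rightarrow> real) set \<Rightarrow> (('i \<Rightarrow> real) \<Rightarrow> real) \<Rightarrow> bool"
  where "sublinear_on V p \<longleftrightarrow>
    (\<forall>y\<in>V. \<forall>w\<in>V. p (y + w) \<le> p y + p w) \<and> (\<forall>r>0. \<forall>y\<in>V. p (r *\<^sub>F y) \<le> r * p y)"

lemma fscale_minus_one: "(-1) *\<^sub>F y = - y"
  by (simp add: fun_eq_iff)

lemma subspaceD:
  assumes "fun_vs.subspace V"
  shows "0 \<in> V" and "y \<in> V \<Longrightarrow> w \<in> V \<Longrightarrow> y + w \<in> V" and "y \<in> V \<Longrightarrow> r *\<^sub>F y \<in> V"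
    and "y \<in> V \<Longrightarrow> - y \<in> V"
  using assms fun_vs.subspace_0 fun_vs.subspace_add fun_vs.subspace_scale fun_vs.subspace_neg
  by blast+

lemma sublinear_on_zero:
  assumes V: "fun_vs.subspace V" and p: "sublinear_on V p"
  shows "p 0 = 0"
proof -
  have "(1 / 2) *\<^sub>F (0 :: 'a \<Rightarrow> real) = 0" by (simp add: fun_eq_iff)
  then have "p 0 \<le> 1 / 2 * p 0"
    using p subspaceD(1)[OF V] unfolding sublinear_on_def by (metis half_gt_zero zero_less_one)
  moreover have "p (0 + 0) \<le> p 0 + p 0"
    using p subspaceD(1)[OF V] unfolding sublinear_on_def by blast
  ultimately show ?thesis by simp
qed

lemma sublinear_on_scale:
  assumes V: "fun_vs.subspace V" and p: "sublinear_on V p" and "y \<in> V" and "r \<ge> 0"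
  shows "p (r *\<^sub>F y) \<le> r * p y"
proof (cases "r = 0")
  case True
  then have "r *\<^sub>F y = 0" by (simp add: fun_eq_iff)
  with True sublinear_on_zero[OF V p] show ?thesis by simp
qed (use assms in \<open>auto simp: sublinear_on_def\<close>)

lemma sublinear_on_neg:
  assumes V: "fun_vs.subspace V" and p: "sublinear_on V p" and y: "y \<in> V"
  shows "- p (- y) \<le> p y"
proof -
  have "p (y + - y) \<le> p y + p (- y)"
    using p y subspaceD(4)[OF V y] unfolding sublinear_on_def by blast
  with sublinear_on_zero[OF V p] show ?thesis by simp
qed

text \<open>The largest sublinear function below \<open>p\<close> whose value at \<open>- w\<close> is at most \<open>- p w\<close>. A linear
  functional below it agrees with \<open>p\<close> at \<open>w\<close>.\<close>

definition tighten :: "(('i \<Rightarrow> real) \<Rightarrow> real) \<Rightarrow> ('i \<Rightarrow> real) \<Rightarrow> ('i \<Rightarrow> real) \<Rightarrow> real"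
  where "tighten p w y = (INF t\<in>{0..}. p (y + t *\<^sub>F w) - t * p w)"

text \<open>The infimum is finite because \<open>t p w \<le> p (y + t w) + p (- y)\<close>.\<close>

lemma
  assumes V: "fun_vs.subspace V" and p: "sublinear_on V p" and w: "w \<in> V"
  shows sublinear_on_tighten: "sublinear_on V (tighten p w)"
    and tighten_le: "y \<in> V \<Longrightarrow> tighten p w y \<le> p y"
    and tighten_neg: "tighten p w (- w) \<le> - p w"
proof -
  note sub = subspaceD[OF V]
  have add: "p (y + z) \<le> p y + p z" if "y \<in> V" "z \<in> V" for y z
    using p that by (auto simp: sublinear_on_def)
  note scale = sublinear_on_scale[OF V p]
  have bdd: "bdd_below ((\<lambda>t. p (y + t *\<^sub>F w) - t * p w) ` {0..})" if y: "y \<in> V" for y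
  proof (rule bdd_belowI2)
    fix t :: real assume t: "t \<in> {0..}"
    show "- p (- y) - p 0 \<le> p (y + t *\<^sub>F w) - t * p w"
    proof (cases "t = 0")
      case True
      then have "y + t *\<^sub>F w = y" by (simp add: fun_eq_iff)
      with True sublinear_on_neg[OF V p y] sublinear_on_zero[OF V p] show ?thesis by simp
    next
      case False
      with t have t: "t > 0" by simp
      have "w = (1 / t) *\<^sub>F ((y + t *\<^sub>F w) + (- y))"
        using t by (auto simp: fun_eq_iff)
      then have "p w \<le> 1 / t * p ((y + t *\<^sub>F w) + (- y))"
        using t y w sub scale[of "(y + t *\<^sub>F w) + (- y)" "1 / t"] by auto
      then have "t * p w \<le> p ((y + t *\<^sub>F w) + (- y))"
        using t by (simp add: field_simps)
      also have "\<dots> \<le> p (y + t *\<^sub>F w) + p (- y)" using y w sub by (intro add) auto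
      finally show ?thesis using sublinear_on_zero[OF V p] by simp
    qed
  qed
  have lower: "tighten p w y \<le> p (y + t *\<^sub>F w) - t * p w" if "y \<in> V" "t \<ge> 0" for y t
    unfolding tighten_def using bdd[OF that(1)] that(2) by (intro cINF_lower) auto
  have near: "\<exists>t\<ge>0. p (y + t *\<^sub>F w) - t * p w < tighten p w y + e" if "e > 0" "y \<in> V" for e y
    using that cINF_less_iff[OF _ bdd[OF that(2)], of "tighten p w y + e"]
    unfolding tighten_def by auto
  show "sublinear_on V (tighten p w)" unfolding sublinear_on_def
  proof (intro conjI ballI allI impI)
    fix y z assume yz: "y \<in> V" "z \<in> V"
    show "tighten p w (y + z) \<le> tighten p w y + tighten p w z"
    proof (rule field_le_epsilon)
      fix e :: real assume e: "e > 0"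
      obtain s where s: "s \<ge> 0" "p (y + s *\<^sub>F w) - s * p w < tighten p w y + e / 2"
        using near[of "e / 2" y] e yz by auto
      obtain t where t: "t \<ge> 0" "p (z + t *\<^sub>F w) - t * p w < tighten p w z + e / 2"
        using near[of "e / 2" z] e yz by auto
      have eq: "y + z + (s + t) *\<^sub>F w = (y + s *\<^sub>F w) + (z + t *\<^sub>F w)"
        by (simp add: fun_eq_iff algebra_simps)
      have "tighten p w (y + z) \<le> p ((y + s *\<^sub>F w) + (z + t *\<^sub>F w)) - (s + t) * p w"
        using lower[OF sub(2)[OF yz], of "s + t"] s t unfolding eq by simp
      also have "\<dots> \<le> p (y + s *\<^sub>F w) + p (z + t *\<^sub>F w) - (s + t) * p w"
        using add[of "y + s *\<^sub>F w" "z + t *\<^sub>F w"] yz w sub by simp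
      finally show "tighten p w (y + z) \<le> tighten p w y + tighten p w z + e"
        using s t by (simp add: algebra_simps)
    qed
  next
    fix r :: real and y assume r: "r > 0" and y: "y \<in> V"
    show "tighten p w (r *\<^sub>F y) \<le> r * tighten p w y"
    proof (rule field_le_epsilon)
      fix e :: real assume e: "e > 0"
      obtain t where t: "t \<ge> 0" "p (y + t *\<^sub>F w) - t * p w < tighten p w y + e / r"
        using near[of "e / r" y] e r y by auto
      have "r *\<^sub>F y + (r * t) *\<^sub>F w = r *\<^sub>F (y + t *\<^sub>F w)"
        by (simp add: fun_eq_iff algebra_simps)
      then have "tighten p w (r *\<^sub>F y) \<le> p (r *\<^sub>F (y + t *\<^sub>F w)) - (r * t) * p w"
        using lower[of "r *\<^sub>F y" "r * t"] y sub r t by simp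
      also have "\<dots> \<le> r * (p (y + t *\<^sub>F w) - t * p w)"
        using scale[of "y + t *\<^sub>F w" r] y w sub r by (simp add: algebra_simps)
      also have "\<dots> \<le> r * (tighten p w y + e / r)" using t r by (intro mult_left_mono) auto
      finally show "tighten p w (r *\<^sub>F y) \<le> r * tighten p w y + e" using r by (simp add: algebra_simps)
    qed
  qed
  show "tighten p w y \<le> p y" if "y \<in> V"
  proof -
    have "y + 0 *\<^sub>F w = y" by (simp add: fun_eq_iff)
    with lower[OF that, of 0] show ?thesis by simp
  qed
  have "- w + 1 *\<^sub>F w = 0" by (simp add: fun_eq_iff)
  with lower[of "- w" 1] sub(4)[OF w] sublinear_on_zero[OF V p] show "tighten p w (- w) \<le> - p w" by simp
qed

text \<open>Zorn's lemma: the pointwise infimum of a chain is again sublinear, and it is finite because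
  every member of the chain is bounded below by \<open>- p (- y)\<close>. Functions are set to \<open>0\<close> off \<open>V\<close> to
  make the pointwise order on \<open>V\<close> antisymmetric.\<close>

lemma exists_minimal_sublinear:
  assumes V: "fun_vs.subspace V" and p: "sublinear_on V p"
  shows "\<exists>q. sublinear_on V q \<and> (\<forall>y\<in>V. q y \<le> p y) \<and>
    (\<forall>q'. sublinear_on V q' \<and> (\<forall>y\<in>V. q' y \<le> q y) \<longrightarrow> (\<forall>y\<in>V. q' y = q y))"
proof -
  define A where "A = {q. sublinear_on V q \<and> (\<forall>y\<in>V. q y \<le> p y) \<and> (\<forall>y. y \<notin> V \<longrightarrow> q y = 0)}"
  define above where "above = (\<lambda>f g :: ('a \<Rightarrow> real) \<Rightarrow> real. \<forall>y\<in>V. g y \<le> f y)"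
  note sub = subspaceD[OF V]
  have cong: "sublinear_on V (\<lambda>y. if y \<in> V then q y else 0) \<longleftrightarrow> sublinear_on V q" for q
    using sub by (auto simp: sublinear_on_def)
  have "\<exists>m\<in>A. \<forall>q\<in>A. above m q \<longrightarrow> q = m"
  proof (rule predicate_Zorn)
    show "partial_order_on A (relation_of above A)"
    proof (rule partial_order_on_relation_ofI)
      fix f g assume "f \<in> A" "g \<in> A" "above f g" "above g f"
      then have "f y = g y" for y
        by (cases "y \<in> V") (auto simp: A_def above_def intro: antisym)
      then show "f = g" by (rule ext)
    qed (auto simp: above_def intro: order_trans)
  next
    fix C assume C: "C \<in> Chains (relation_of above A)"
    show "\<exists>l\<in>A. \<forall>q\<in>C. above q l"
    proof (cases "C = {}")
      case True
      have "(\<lambda>y. if y \<in> V then p y else 0) \<in> A" using p by (auto simp: A_def cong)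
      with True show ?thesis by blast
    next
      case False
      have CA: "q \<in> A" if "q \<in> C" for q
        using C that by (auto simp: Chains_def relation_of_def)
      have chain: "above f g \<or> above g f" if "f \<in> C" "g \<in> C" for f g
        using C that by (auto simp: Chains_def relation_of_def)
      define l where "l y = (INF q\<in>C. q y)" for y
      have bdd: "bdd_below ((\<lambda>q. q y) ` C)" if y: "y \<in> V" for y
      proof (rule bdd_belowI2)
        fix q assume "q \<in> C"
        then have "q \<in> A" by (rule CA)
        then show "- p (- y) \<le> q y"
          using sublinear_on_neg[OF V _ y, of q] sub(4)[OF y] by (force simp: A_def)
      qed
      have lower: "l y \<le> q y" if "q \<in> C" "y \<in> V" for q y
        unfolding l_def using bdd[OF that(2)] that(1) by (intro cINF_lower)
      have near: "\<exists>q\<in>C. q y < l y + e" if "e > 0" "y \<in> V" for e y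
        using that cINF_less_iff[OF False bdd[OF that(2)], of "l y + e"] unfolding l_def by auto
      have "sublinear_on V l" unfolding sublinear_on_def
      proof (intro conjI ballI allI impI)
        fix y z assume yz: "y \<in> V" "z \<in> V"
        show "l (y + z) \<le> l y + l z"
        proof (rule field_le_epsilon)
          fix e :: real assume "e > 0"
          then obtain f g where fg: "f \<in> C" "f y < l y + e / 2" "g \<in> C" "g z < l z + e / 2"
            using near[of "e / 2"] yz by (metis half_gt_zero)
          have "\<exists>q\<in>C. q y \<le> f y \<and> q z \<le> g z"
            using chain[OF fg(1,3)] fg(1,3) yz unfolding above_def by blast
          then obtain q where q: "q \<in> C" "q y \<le> f y" "q z \<le> g z" by blast
          have "l (y + z) \<le> q (y + z)" by (rule lower[OF q(1) sub(2)[OF yz]])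
          also have "\<dots> \<le> q y + q z" using CA[OF q(1)] yz by (auto simp: A_def sublinear_on_def)
          finally show "l (y + z) \<le> l y + l z + e" using q fg by linarith
        qed
      next
        fix r :: real and y assume r: "r > 0" and y: "y \<in> V"
        show "l (r *\<^sub>F y) \<le> r * l y"
        proof (rule field_le_epsilon)
          fix e :: real assume "e > 0"
          then obtain q where q: "q \<in> C" "q y < l y + e / r"
            using near[of "e / r" y] r y by auto
          have "l (r *\<^sub>F y) \<le> q (r *\<^sub>F y)" by (rule lower[OF q(1) sub(3)[OF y]])
          also have "\<dots> \<le> r * q y" using CA[OF q(1)] y r by (auto simp: A_def sublinear_on_def)
          also have "\<dots> \<le> r * (l y + e / r)" using q r by (intro mult_left_mono) auto
          finally show "l (r *\<^sub>F y) \<le> r * l y + e" using r by (simp add: algebra_simps)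
        qed
      qed
      moreover have "l y \<le> p y" if y: "y \<in> V" for y
      proof -
        from False obtain q where "q \<in> C" by blast
        with lower[OF this y] CA[OF this] y show ?thesis by (force simp: A_def)
      qed
      ultimately have "(\<lambda>y. if y \<in> V then l y else 0) \<in> A" by (auto simp: A_def cong)
      moreover have "above q (\<lambda>y. if y \<in> V then l y else 0)" if "q \<in> C" for q
        using lower that by (auto simp: above_def)
      ultimately show ?thesis by blast
    qed
  qed
  then obtain m where m: "m \<in> A" "\<And>q. q \<in> A \<Longrightarrow> above m q \<Longrightarrow> q = m" by blast
  have "q y = m y" if q: "sublinear_on V q" "\<forall>y\<in>V. q y \<le> m y" and y: "y \<in> V" for q y
  proof -
    have "(\<lambda>y. if y \<in> V then q y else 0) \<in> A"
      using q m(1) by (force simp: A_def cong)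
    then have "(\<lambda>y. if y \<in> V then q y else 0) = m"
      using q(2) by (intro m(2)) (auto simp: above_def)
    from fun_cong[OF this, of y] y show ?thesis by simp
  qed
  with m(1) show ?thesis by (auto simp: A_def)
qed

lemma linear_of_odd_sublinear:
  assumes V: "fun_vs.subspace V" and q: "sublinear_on V q"
    and odd: "\<And>y. y \<in> V \<Longrightarrow> q (- y) \<le> - q y"
  shows "linear_functional_on V q"
proof -
  note sub = subspaceD[OF V]
  have odd': "q (- y) = - q y" if "y \<in> V" for y
    using odd[OF that] sublinear_on_neg[OF V q that] by simp
  have add: "q (y + w) \<le> q y + q w" if "y \<in> V" "w \<in> V" for y w
    using q that by (auto simp: sublinear_on_def)
  have pos: "q (r *\<^sub>F y) = r * q y" if r: "r > 0" and y: "y \<in> V" for r y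
  proof (rule antisym)
    have le: "q (s *\<^sub>F z) \<le> s * q z" if "s > 0" "z \<in> V" for s z
      using q that by (auto simp: sublinear_on_def)
    show "q (r *\<^sub>F y) \<le> r * q y" by (rule le[OF r y])
    have "r *\<^sub>F (- y) = - (r *\<^sub>F y)" by (simp add: fun_eq_iff)
    then have "q (- (r *\<^sub>F y)) \<le> r * q (- y)" using le[OF r sub(4)[OF y]] by simp
    then show "r * q y \<le> q (r *\<^sub>F y)" using odd' y sub(3)[OF y] by simp
  qed
  show ?thesis unfolding linear_functional_on_def
  proof (intro conjI ballI allI)
    fix y w assume yw: "y \<in> V" "w \<in> V"
    have "- y + - w = - (y + w)" by simp
    then have "q (- (y + w)) \<le> q (- y) + q (- w)"
      using add[OF sub(4)[OF yw(1)] sub(4)[OF yw(2)]] by metis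
    then have "- q (y + w) \<le> - q y + - q w"
      unfolding odd'[OF sub(2)[OF yw]] odd'[OF yw(1)] odd'[OF yw(2)] .
    with add[OF yw] show "q (y + w) = q y + q w" by simp
  next
    fix r y assume y: "y \<in> V"
    show "q (r *\<^sub>F y) = r * q y"
    proof (cases r "0 :: real" rule: linorder_cases)
      case less
      have "q (r *\<^sub>F y) = q (- ((- r) *\<^sub>F y))"
        by (rule arg_cong[of _ _ q]) (simp add: fun_eq_iff)
      also have "\<dots> = - ((- r) * q y)"
        unfolding odd'[OF sub(3)[OF y]] using pos[of "- r" y] less y by simp
      finally show ?thesis by simp
    next
      case equal
      then have "r *\<^sub>F y = 0" by (simp add: fun_eq_iff)
      with equal sublinear_on_zero[OF V q] show ?thesis by simp
    qed (use pos y in blast)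
  qed
qed

text \<open>A form of the Hahn-Banach theorem. Tightening a minimal sublinear function along any vector
  leaves it unchanged, so it is odd, and an odd sublinear function is linear. Starting from \<open>p\<close>
  tightened along \<open>w\<close> forces the resulting functional to touch \<open>p\<close> at \<open>w\<close>.\<close>

lemma sublinear_supporting_functional:
  assumes V: "fun_vs.subspace V" and p: "sublinear_on V p" and w: "w \<in> V"
  shows "\<exists>\<psi>. linear_functional_on V \<psi> \<and> (\<forall>y\<in>V. \<psi> y \<le> p y) \<and> \<psi> w = p w"
proof -
  obtain q where q: "sublinear_on V q" "\<And>y. y \<in> V \<Longrightarrow> q y \<le> tighten p w y"
    and min: "\<forall>q'. sublinear_on V q' \<and> (\<forall>y\<in>V. q' y \<le> q y) \<longrightarrow> (\<forall>y\<in>V. q' y = q y)"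
    using exists_minimal_sublinear[OF V sublinear_on_tighten[OF V p w]] by metis
  have odd: "q (- y) \<le> - q y" if y: "y \<in> V" for y
  proof -
    have "tighten q y (- y) = q (- y)"
      using min[rule_format, of "tighten q y" "- y"] sublinear_on_tighten[OF V q(1) y]
        tighten_le[OF V q(1) y] subspaceD(4)[OF V y]
      by simp
    with tighten_neg[OF V q(1) y] show ?thesis by simp
  qed
  have le: "q y \<le> p y" if "y \<in> V" for y
    using q(2)[OF that] tighten_le[OF V p w that] by (rule order_trans)
  moreover have "q w = p w"
    using le[OF w] q(2)[OF subspaceD(4)[OF V w]] tighten_neg[OF V p w]
      sublinear_on_neg[OF V q(1) w] by linarith
  ultimately show ?thesis using linear_of_odd_sublinear[OF V q(1) odd] by (intro exI[of _ q]) simp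
qed

section \<open>The optimal value function and the dual\<close>

lemma feasible_set_add:
  "x \<in> feasible_set I a y \<Longrightarrow> x' \<in> feasible_set I a w \<Longrightarrow> x + x' \<in> feasible_set I a (y + w)"
  by (auto simp: feasible_set_def sum.distrib distrib_left intro: add_mono)

lemma feasible_set_scale:
  "x \<in> feasible_set I a y \<Longrightarrow> r \<ge> 0 \<Longrightarrow> r *\<^sub>R x \<in> feasible_set I a (r *\<^sub>F y)"
proof -
  assume x: "x \<in> feasible_set I a y" and r: "r \<ge> 0"
  have "(\<Sum>k\<in>UNIV. a k i * (r *\<^sub>R x) $ k) = r * (\<Sum>k\<in>UNIV. a k i * x $ k)" for i
    by (simp add: sum_distrib_left mult.left_commute)
  with x r show ?thesis by (auto simp: feasible_set_def intro: mult_left_mono)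
qed

lemma sublinear_on_OV:
  assumes V: "fun_vs.subspace V" and p: "\<And>y. y \<in> V \<Longrightarrow> OV I a c y = ereal (p y)"
  shows "sublinear_on V p"
  unfolding sublinear_on_def
proof (intro conjI ballI allI impI)
  note sub = subspaceD[OF V]
  have near: "\<exists>x\<in>feasible_set I a y. (\<Sum>k\<in>UNIV. c $ k * x $ k) < p y + e"
    if "y \<in> V" "e > 0" for y e
    using OV_less_obtain[of I a c y "p y + e"] p[OF that(1)] that(2) by auto
  have le: "p y \<le> (\<Sum>k\<in>UNIV. c $ k * x $ k)" if "y \<in> V" "x \<in> feasible_set I a y" for x y
    using OV_le[OF that(2), of c] p[OF that(1)] by simp
  {
    fix y w assume yw: "y \<in> V" "w \<in> V"
    show "p (y + w) \<le> p y + p w"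
    proof (rule field_le_epsilon)
      fix e :: real assume e: "e > 0"
      from near[of y "e / 2"] yw e obtain x where
        x: "x \<in> feasible_set I a y" "(\<Sum>k\<in>UNIV. c $ k * x $ k) < p y + e / 2" by auto
      from near[of w "e / 2"] yw e obtain x' where
        x': "x' \<in> feasible_set I a w" "(\<Sum>k\<in>UNIV. c $ k * x' $ k) < p w + e / 2" by auto
      have "p (y + w) \<le> (\<Sum>k\<in>UNIV. c $ k * (x + x') $ k)"
        by (rule le[OF sub(2)[OF yw] feasible_set_add[OF x(1) x'(1)]])
      also have "\<dots> = (\<Sum>k\<in>UNIV. c $ k * x $ k) + (\<Sum>k\<in>UNIV. c $ k * x' $ k)"
        by (simp add: sum.distrib distrib_left)
      finally show "p (y + w) \<le> p y + p w + e" using x(2) x'(2) by simp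
    qed
  next
    fix r :: real and y assume r: "r > 0" and y: "y \<in> V"
    show "p (r *\<^sub>F y) \<le> r * p y"
    proof (rule field_le_epsilon)
      fix e :: real assume e: "e > 0"
      from near[of y "e / r"] y e r obtain x where
        x: "x \<in> feasible_set I a y" "(\<Sum>k\<in>UNIV. c $ k * x $ k) < p y + e / r" by auto
      have "p (r *\<^sub>F y) \<le> (\<Sum>k\<in>UNIV. c $ k * (r *\<^sub>R x) $ k)"
        using r by (intro le[OF sub(3)[OF y]] feasible_set_scale[OF x(1)]) simp
      also have "\<dots> = r * (\<Sum>k\<in>UNIV. c $ k * x $ k)"
        by (simp add: sum_distrib_left mult.left_commute)
      also have "\<dots> \<le> r * (p y + e / r)" using x(2) r by (intro mult_left_mono) auto
      finally show "p (r *\<^sub>F y) \<le> r * p y + e" using r by (simp add: distrib_left)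
    qed
  }
qed

lemma linear_functional_onD:
  assumes "linear_functional_on V \<psi>" and "y \<in> V"
  shows "w \<in> V \<Longrightarrow> \<psi> (y + w) = \<psi> y + \<psi> w" and "\<psi> (r *\<^sub>F y) = r * \<psi> y" and "\<psi> (- y) = - \<psi> y"
proof -
  show scale: "\<psi> (r *\<^sub>F y) = r * \<psi> y" for r
    using assms unfolding linear_functional_on_def by blast
  show "\<psi> (- y) = - \<psi> y" using scale[of "-1"] unfolding fscale_minus_one by simp
qed (use assms in \<open>simp add: linear_functional_on_def\<close>)

lemma linear_functional_on_sum:
  assumes V: "fun_vs.subspace V" and \<psi>: "linear_functional_on V \<psi>"
    and "finite A" and "\<And>k. k \<in> A \<Longrightarrow> f k \<in> V"
  shows "(\<Sum>k\<in>A. f k) \<in> V \<and> \<psi> (\<Sum>k\<in>A. f k) = (\<Sum>k\<in>A. \<psi> (f k))"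
  using assms(3,4)
proof (induction A rule: finite_induct)
  case empty
  have "0 *\<^sub>F (0 :: 'a \<Rightarrow> real) = 0" by (simp add: fun_eq_iff)
  then have "\<psi> 0 = 0 * \<psi> 0"
    using \<psi> subspaceD(1)[OF V] unfolding linear_functional_on_def by metis
  with subspaceD(1)[OF V] show ?case by (simp only: sum.empty mult_zero_left)
next
  case (insert k A)
  then have IH: "f k \<in> V" "(\<Sum>k\<in>A. f k) \<in> V" "\<psi> (\<Sum>k\<in>A. f k) = (\<Sum>k\<in>A. \<psi> (f k))" by auto
  then have "\<psi> (f k + (\<Sum>k\<in>A. f k)) = \<psi> (f k) + (\<Sum>k\<in>A. \<psi> (f k))"
    using \<psi> by (simp add: linear_functional_on_def)
  with subspaceD(2)[OF V IH(1,2)] show ?case by (simp only: sum.insert[OF insert.hyps])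
qed

lemma DSILP_weak_duality:
  assumes V: "fun_vs.subspace V" and a: "\<And>k. a k \<in> V" and y: "y \<in> V"
    and \<phi>: "DSILP_feasible I a c V \<phi>"
  shows "ereal (\<phi> y) \<le> OV I a c y"
  unfolding OV_def
proof (rule INF_greatest)
  fix x assume x: "x \<in> feasible_set I a y"
  note sub = subspaceD[OF V]
  from \<phi> have lin: "linear_functional_on V \<phi>" and pos: "positive_on I V \<phi>"
    and \<phi>a: "\<And>k. \<phi> (a k) = c $ k"
    by (auto simp: DSILP_feasible_def)
  let ?s = "\<Sum>k\<in>UNIV. (x $ k) *\<^sub>F a k"
  have s: "?s \<in> V" "\<phi> ?s = (\<Sum>k\<in>UNIV. \<phi> ((x $ k) *\<^sub>F a k))"
    using linear_functional_on_sum[OF V lin, of UNIV "\<lambda>k. (x $ k) *\<^sub>F a k"] a sub by auto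
  have s_apply: "?s i = (\<Sum>k\<in>UNIV. a k i * x $ k)" for i
  proof -
    have "(\<Sum>k\<in>A. (x $ k) *\<^sub>F a k) i = (\<Sum>k\<in>A. a k i * x $ k)" if "finite A" for A
      using that by (induction A rule: finite_induct) (simp_all add: mult.commute)
    then show ?thesis by simp
  qed
  have "\<forall>i\<in>I. (?s + - y) i \<ge> 0"
    using x by (simp add: s_apply feasible_set_def)
  then have "0 \<le> \<phi> (?s + - y)"
    using pos sub(2)[OF s(1) sub(4)[OF y]] unfolding positive_on_def by blast
  also have "\<dots> = \<phi> ?s - \<phi> y"
    using linear_functional_onD(1)[OF lin s(1) sub(4)[OF y]] linear_functional_onD(3)[OF lin y]
    by linarith
  also have "\<phi> ?s = (\<Sum>k\<in>UNIV. c $ k * x $ k)"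
    using lin a by (simp add: s(2) linear_functional_on_def \<phi>a mult.commute)
  finally show "ereal (\<phi> y) \<le> ereal (\<Sum>k\<in>UNIV. c $ k * x $ k)" by simp
qed

text \<open>Together with weak duality this identifies the dual feasible functionals as the linear minorants
  of the optimal value function. A nonnegative \<open>y\<close> has \<open>OV (- y) \<le> 0\<close> because \<open>0\<close> is feasible, and
  the unit vectors and their negatives give \<open>OV (a k) \<le> c k\<close> and \<open>OV (- a k) \<le> - c k\<close>.\<close>

lemma DSILP_feasible_of_dominated:
  assumes V: "fun_vs.subspace V" and a: "\<And>k. a k \<in> V"
    and lin: "linear_functional_on V \<psi>"
    and le: "\<And>y. y \<in> V \<Longrightarrow> ereal (\<psi> y) \<le> OV I a c y"
  shows "DSILP_feasible I a c V \<psi>"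
proof -
  note sub = subspaceD[OF V]
  note neg = linear_functional_onD(3)[OF lin]
  have bound: "\<psi> y \<le> (\<Sum>k\<in>UNIV. c $ k * x $ k)" if "y \<in> V" "x \<in> feasible_set I a y" for x y
    using order_trans[OF le[OF that(1)] OV_le[OF that(2), of c]] by simp
  have "\<psi> y \<ge> 0" if y: "y \<in> V" "\<forall>i\<in>I. y i \<ge> 0" for y
    using bound[of "- y" 0] y sub neg by (auto simp: feasible_set_def)
  moreover have "\<psi> (a k) = c $ k" for k
  proof -
    have axis: "(\<Sum>l\<in>UNIV. f l * axis k r $ l) = f k * r" for f :: "'b \<Rightarrow> real" and r
    proof -
      have "(\<Sum>l\<in>UNIV. f l * axis k r $ l) = (\<Sum>l\<in>UNIV. if l = k then f k * r else 0)"
        by (rule sum.cong) (auto simp: axis_def)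
      then show ?thesis by simp
    qed
    have "axis k 1 \<in> feasible_set I a (a k)" "axis k (-1) \<in> feasible_set I a (- a k)"
      by (simp_all add: feasible_set_def axis)
    from bound[OF a this(1)] bound[OF sub(4)[OF a] this(2)] show ?thesis
      by (simp add: axis neg a)
  qed
  ultimately show ?thesis using lin by (simp add: DSILP_feasible_def positive_on_def)
qed

section \<open>Strong duality along a perturbation direction\<close>

theorem theorem5p12:
  fixes I :: "'i set"
    and a :: "'n::finite \<Rightarrow> 'i \<Rightarrow> real"
    and b :: "'i \<Rightarrow> real"
    and c :: "real ^ 'n"
    and Y Yhat :: "('i \<Rightarrow> real) set"
    and H :: "('i, 'n) fm_row set"
    and u :: "('i, 'n) fm_row \<Rightarrow> 'i option \<Rightarrow> real"
    and R :: "'n set"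
  assumes "\<And>k. a k \<in> RI I" and "b \<in> RI I"
    and feasible: "feasible_set I a b \<noteq> {}"
    and bounded: "OV I a c b > -\<infinity>"
    and "Y \<subseteq> RI I" and "fun_vs.subspace Y"
    and "fun_vs.span (insert b (range a)) \<subseteq> Y"
    and Yhat: "Yhat = {y \<in> Y. -\<infinity> < OV I a c y \<and> OV I a c y < \<infinity>}"
    and "fun_vs.subspace Yhat"
    and "fun_vs.span (insert b (range a)) \<subseteq> Yhat"
    and fm: "fm_output I a c H u R"
    and "FMbar u ` Yhat \<subseteq> linf H"
    and DP1: "I3 a c H u \<noteq> {} \<Longrightarrow>
      (SUP h \<in> {h :: nat \<Rightarrow> ('i, 'n) fm_row. range h \<subseteq> I3 a c H u \<and>
                  limsup (\<lambda>m. ereal (FMbar u b (h m))) < S_val a c H u b}.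
         limsup (\<lambda>m. ereal (FMbar u b (h m)))) < S_val a c H u b"
    and DP2: "I4 a c H u R \<noteq> {} \<Longrightarrow>
      (SUP h \<in> {h :: nat \<Rightarrow> ('i, 'n) fm_row. range h \<subseteq> I4 a c H u R \<and>
                  limsup (\<lambda>m. ereal (FMbar u b (h m))) < L_val a c H u R b \<and>
                  (\<lambda>m. abs_sum a c u R (h m)) \<longlonglongrightarrow> 0}.
         limsup (\<lambda>m. ereal (FMbar u b (h m)))) < L_val a c H u R b"
  shows "\<forall>d\<in>Yhat. feasible_set I a (b + d) \<noteq> {} \<longrightarrow>
    (\<exists>\<psi> \<epsilon>'. DSILP_optimal I a b c Yhat \<psi> \<and> \<epsilon>' > 0 \<and>
      (\<forall>\<epsilon>\<in>{0..\<epsilon>'}. OV I a c (b + \<epsilon> *\<^sub>F d) = ereal (\<psi> (b + \<epsilon> *\<^sub>F d)) \<and>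
         ereal (\<psi> (b + \<epsilon> *\<^sub>F d)) = OV I a c b + ereal (\<epsilon> * \<psi> d)))"
proof (intro ballI impI)
  fix d assume d: "d \<in> Yhat"
  note V = \<open>fun_vs.subspace Yhat\<close>
  note sub = subspaceD[OF V]
  have b: "b \<in> Yhat" and a: "\<And>k. a k \<in> Yhat"
    using \<open>fun_vs.span (insert b (range a)) \<subseteq> Yhat\<close> fun_vs.span_superset[of "insert b (range a)"]
    by blast+
  have bd: "b + t *\<^sub>F d \<in> Yhat" for t
    using b d sub by simp
  define p where "p y = real_of_ereal (OV I a c y)" for y
  have p: "OV I a c y = ereal (p y)" if "y \<in> Yhat" for y
  proof -
    have "- \<infinity> < OV I a c y" "OV I a c y < \<infinity>" using that Yhat by blast+
    then show ?thesis unfolding p_def by (cases "OV I a c y") auto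
  qed
  have sublin: "sublinear_on Yhat p" by (rule sublinear_on_OV[OF V p])
  let ?F = "flat_rows a c H u R"
  have lim: "Limsup ?F (\<lambda>h. ereal (FMbar u b h + t * FMbar u d h)) = ereal (p (b + t *\<^sub>F d))" for t
    using OV_eq_Limsup[OF fm p[OF bd, of t]] \<open>FMbar u ` Yhat \<subseteq> linf H\<close> bd[of t]
    unfolding FMbar_add_scale[OF fm, symmetric] by blast
  have "b + 0 *\<^sub>F d = b" by (simp add: fun_eq_iff)
  with lim[of 0] have lim0: "Limsup ?F (\<lambda>h. ereal (FMbar u b h)) = ereal (p b)" by simp
  from flat_rows_gap[OF fm p[OF b] DP1 DP2] obtain \<sigma> where \<sigma>: "\<sigma> < p b"
    and gap: "\<And>k. k > 0 \<Longrightarrow> \<forall>\<^sub>F h in ?F. FMbar u b h > \<sigma> \<longrightarrow> FMbar u b h > p b - k"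
    by blast
  have "FMbar u d \<in> linf H" using \<open>FMbar u ` Yhat \<subseteq> linf H\<close> d by blast
  then obtain M where M: "M > 0" "\<And>h. h \<in> H \<Longrightarrow> \<bar>FMbar u d h\<bar> \<le> M"
    by (auto simp: linf_def bounded_pos)
  then have bdd: "\<forall>\<^sub>F h in ?F. \<bar>FMbar u d h\<bar> \<le> M"
    unfolding eventually_flat_rows by (intro exI[of _ 1]) simp
  \<comment> \<open>On this segment the perturbation moves every row by at most a quarter of the gap.\<close>
  define e where "e = (p b - \<sigma>) / (4 * M)"
  have e: "e > 0" "2 * e * M < p b - \<sigma>" using \<sigma> M(1) by (simp_all add: e_def field_simps)
  have mid: "(p b + p (b + e *\<^sub>F d)) / 2 \<le> p (b + (e / 2) *\<^sub>F d)"
    by (rule Limsup_midpoint[OF lim0 lim lim bdd e gap])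
  \<comment> \<open>A minorant that touches \<open>p\<close> at the midpoint must touch it at both ends, as \<open>mid\<close> leaves no room.\<close>
  from sublinear_supporting_functional[OF V sublin bd, of "e / 2"] obtain \<psi> where
    lin: "linear_functional_on Yhat \<psi>" and le: "\<And>y. y \<in> Yhat \<Longrightarrow> \<psi> y \<le> p y"
    and touch: "\<psi> (b + (e / 2) *\<^sub>F d) = p (b + (e / 2) *\<^sub>F d)"
    by blast
  have \<psi>: "\<psi> (b + t *\<^sub>F d) = \<psi> b + t * \<psi> d" for t
    using lin b d sub by (simp add: linear_functional_on_def)
  have ends: "\<psi> b = p b" "\<psi> (b + e *\<^sub>F d) = p (b + e *\<^sub>F d)"
    using le[OF b] le[OF bd[of e]] mid touch \<psi>[of e] \<psi>[of "e / 2"] by (simp_all add: field_simps)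
  \<comment> \<open>Convexity of \<open>p\<close> bounds it by the affine interpolation of the end values, which is \<open>\<psi>\<close>.\<close>
  have on_segment: "p (b + t *\<^sub>F d) = \<psi> (b + t *\<^sub>F d)" if t: "t \<in> {0..e}" for t
  proof (rule antisym)
    define s where "s = t / e"
    have s: "0 \<le> s" "s \<le> 1" "t = s * e" using t e(1) by (simp_all add: s_def)
    have "b + t *\<^sub>F d = (1 - s) *\<^sub>F b + s *\<^sub>F (b + e *\<^sub>F d)"
      by (simp add: fun_eq_iff s(3) algebra_simps)
    then have "p (b + t *\<^sub>F d) \<le> p ((1 - s) *\<^sub>F b) + p (s *\<^sub>F (b + e *\<^sub>F d))"
      using sublin sub(3)[OF b] sub(3)[OF bd] by (simp add: sublinear_on_def)
    also have "\<dots> \<le> (1 - s) * p b + s * p (b + e *\<^sub>F d)"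
      using s by (intro add_mono sublinear_on_scale[OF V sublin] b bd) auto
    also have "\<dots> = \<psi> (b + t *\<^sub>F d)"
      using \<psi>[of t] \<psi>[of e] unfolding ends(2)[symmetric] by (simp add: ends(1) s(3) algebra_simps)
    finally show "p (b + t *\<^sub>F d) \<le> \<psi> (b + t *\<^sub>F d)" .
  qed (rule le[OF bd])
  have "DSILP_feasible I a c Yhat \<psi>"
    using le p by (intro DSILP_feasible_of_dominated[OF V a lin]) auto
  moreover have "\<phi> b \<le> \<psi> b" if "DSILP_feasible I a c Yhat \<phi>" for \<phi>
    using DSILP_weak_duality[OF V a b that] by (simp add: p[OF b] ends(1))
  ultimately have "DSILP_optimal I a b c Yhat \<psi>" by (simp add: DSILP_optimal_def)
  then show "\<exists>\<psi> \<epsilon>'. DSILP_optimal I a b c Yhat \<psi> \<and> \<epsilon>' > 0 \<and>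
      (\<forall>\<epsilon>\<in>{0..\<epsilon>'}. OV I a c (b + \<epsilon> *\<^sub>F d) = ereal (\<psi> (b + \<epsilon> *\<^sub>F d)) \<and>
         ereal (\<psi> (b + \<epsilon> *\<^sub>F d)) = OV I a c b + ereal (\<epsilon> * \<psi> d))"
    using e(1) on_segment
    by (intro exI[of _ \<psi>] exI[of _ e]) (simp add: p[OF bd] p[OF b] ends(1) \<psi>)
qed

end
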